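(* Let $C: f=0$ be an arrangement of $d$ lines in $\mathbb{P}^2$ which is not free and such that $r=mdr(f)\ge 3$ and $n(C)\ge 3$. Put $\tau(d,r)_{min}=(d-1)(d-r-1)$. Then $$\tau(C)\ \ge\ \tau(d,r)_{min}+\binom{r}{2}+4\ \ge\ \tau(d,r)_{min}+7 .$$
   Context: Let $S=\mathbb{C}[x,y,z]$ with its standard grading, with $S_m$ the space of homogeneous polynomials of degree $m$. An arrangement of $d$ lines in the complex projective plane $\mathbb{P}^2$ is a reduced curve $C:f=0$, where $f\in S_d$ is a product of $d$ pairwise non-proportional linear forms. Write $f_x,f_y,f_z$ for the partial derivatives of $f$. $AR(f)\subset S^3$ is the graded $S$-module of Jacobian syzygies: its degree $q$ part $AR(f)_q$ consists of the triples $(a,b,c)\in S_q^3$ with $af_x+bf_y+cf_z=0$. The integer $mdr(f)$ is the smallest $m\ge 0$ such that $AR(f)_m\ne 0$. The curve $C$ is free if $AR(f)$ is a free graded $S$-module (of rank 2). $\tau(C)$ is the global Tjurina number of $C$, i.e. the sum of the Tjurina numbers of the singular points of $C$. For a line arrangement, $\tau(C)=\sum_p (n(p)-1)^2$, the sum being over all multiple points $p$ of $C$, where $n(p)$ is the multiplicity of $C$ at $p$ (the number of lines of $C$ through $p$). $m(C)$ is the maximal multiplicity of a point of $C$, and $n(C)$ is the maximal multiplicity of a point in $C\setminus\{p\}$, where $p$ is any point of $C$ of multiplicity $m(C)$. *)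

theory Defs
  imports
    "HOL-Analysis.Analysis"
    "HOL-Library.Poly_Mapping"
    "HOL-Computational_Algebra.Formal_Power_Series"
begin

(* S = C[x,y,z]: an exponent vector is a finitely supported map from the index type 3
   (inhabited by 0, 1, 2) to nat, and a polynomial is a finitely supported map from exponent
   vectors to complex numbers; the product on poly_mapping is convolution. *)
type_synonym S = "(3 \<Rightarrow>\<^sub>0 nat) \<Rightarrow>\<^sub>0 complex"

definition const :: "complex \<Rightarrow> S" where
  "const c = Poly_Mapping.single 0 c"

definition homogeneous :: "nat \<Rightarrow> S \<Rightarrow> bool" where
  "homogeneous q f \<longleftrightarrow>
     (\<forall>m \<in> Poly_Mapping.keys f. (\<Sum>i\<in>UNIV. Poly_Mapping.lookup m i) = q)"

(* A monomial with exponent 0 at i contributes 0, so the truncated subtraction is harmless. *)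
definition pdiff :: "3 \<Rightarrow> S \<Rightarrow> S" where
  "pdiff i f = (\<Sum>m\<in>Poly_Mapping.keys f.
     Poly_Mapping.single (m - Poly_Mapping.single i 1)
       (of_nat (Poly_Mapping.lookup m i) * Poly_Mapping.lookup f m))"

(* f with the variables replaced by the elements a 0, a 1, a 2 of a commutative ring R;
   emb is the structure map from the complex numbers to R. *)
definition subst :: "(complex \<Rightarrow> 'r::comm_ring_1) \<Rightarrow> (3 \<Rightarrow> 'r) \<Rightarrow> S \<Rightarrow> 'r" where
  "subst emb a f = (\<Sum>m\<in>Poly_Mapping.keys f.
     emb (Poly_Mapping.lookup f m) * (\<Prod>i\<in>UNIV. a i ^ Poly_Mapping.lookup m i))"

definition eval :: "S \<Rightarrow> complex ^ 3 \<Rightarrow> complex" where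
  "eval f v = subst (\<lambda>c. c) (vec_nth v) f"


(* Points of the projective plane are the one-dimensional subspaces of C^3. *)
definition P2 :: "(complex ^ 3) set set" where
  "P2 = {vec.span {v} | v. v \<noteq> 0}"

definition vanishes_at :: "S \<Rightarrow> (complex ^ 3) set \<Rightarrow> bool" where
  "vanishes_at f p \<longleftrightarrow> (\<forall>v\<in>p. eval f v = 0)"

definition curve :: "S \<Rightarrow> (complex ^ 3) set set" where
  "curve f = {p \<in> P2. vanishes_at f p}"

definition singular_points :: "S \<Rightarrow> (complex ^ 3) set set" where
  "singular_points f = {p \<in> curve f. \<forall>i. vanishes_at (pdiff i f) p}"


(* A is the set of linear forms; the arrangement is the curve defined by their product. *)
definition line_arrangement :: "S set \<Rightarrow> bool" where
  "line_arrangement A \<longleftrightarrow>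
     finite A \<and>
     (\<forall>l\<in>A. l \<noteq> 0 \<and> homogeneous 1 l) \<and>
     (\<forall>l\<in>A. \<forall>l'\<in>A. l \<noteq> l' \<longrightarrow> (\<nexists>c. l' = const c * l))"

definition mult_at :: "S set \<Rightarrow> (complex ^ 3) set \<Rightarrow> nat" where
  "mult_at A p = card {l \<in> A. vanishes_at l p}"

definition max_mult :: "S set \<Rightarrow> nat" where
  "max_mult A = Max (mult_at A ` curve (\<Prod>A))"

(* The value does not depend on which point p of maximal multiplicity is removed. *)
definition second_mult :: "S set \<Rightarrow> nat" where
  "second_mult A =
     (let p = SOME p. p \<in> curve (\<Prod>A) \<and> mult_at A p = max_mult A
      in Max (mult_at A ` (curve (\<Prod>A) - {p})))"


definition AR :: "S \<Rightarrow> (S ^ 3) set" where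
  "AR f = {s. (\<Sum>i\<in>UNIV. s $ i * pdiff i f) = 0}"

definition AR_deg :: "S \<Rightarrow> nat \<Rightarrow> (S ^ 3) set" where
  "AR_deg f q = {s \<in> AR f. \<forall>i. homogeneous q (s $ i)}"

definition mdr :: "S \<Rightarrow> nat" where
  "mdr f = (LEAST m. AR_deg f m \<noteq> {0})"

lemma module_S3: "module ((*s) :: S \<Rightarrow> S ^ 3 \<Rightarrow> S ^ 3)"
  by unfold_locales (simp_all add: vec_eq_iff algebra_simps)

(* AR f has a basis over S consisting of two homogeneous elements. *)
definition free_curve :: "S \<Rightarrow> bool" where
  "free_curve f \<longleftrightarrow>
     (\<exists>B. B \<subseteq> (\<Union>q. AR_deg f q) \<and> finite B \<and> card B = 2 \<and>
          \<not> module.dependent ((*s) :: S \<Rightarrow> S ^ 3 \<Rightarrow> S ^ 3) B \<and>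
          module.span ((*s) :: S \<Rightarrow> S ^ 3 \<Rightarrow> S ^ 3) B = AR f)"


(* C[[U,V]] as the ring of power series in V over C[[U]]: the coefficient of U^m V^n in g
   is the m-th coefficient of the n-th coefficient of g. *)
type_synonym local_ring = "complex fps fps"

definition emb :: "complex \<Rightarrow> local_ring" where
  "emb c = fps_const (fps_const c)"

definition U :: local_ring where "U = fps_const fps_X"

definition V :: local_ring where "V = fps_X"

definition deriv_U :: "local_ring \<Rightarrow> local_ring" where
  "deriv_U g = Abs_fps (\<lambda>n. fps_deriv (fps_nth g n))"

definition deriv_V :: "local_ring \<Rightarrow> local_ring" where
  "deriv_V g = fps_deriv g"

(* Local equation of f = 0 at p in an affine chart x_i = 1 containing p, with the two affine
   coordinates (whose indices i + 1 and i + 2 are taken modulo 3) centred at p. *)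
definition local_eq :: "S \<Rightarrow> (complex ^ 3) set \<Rightarrow> local_ring" where
  "local_eq f p =
     (let i = SOME i. \<exists>v\<in>p. v $ i \<noteq> 0;
          v = THE v. v \<in> p \<and> v $ i = 1
      in subst emb
           (\<lambda>j. if j = i then 1
                else if j = i + 1 then emb (v $ j) + U
                else emb (v $ j) + V) f)"

definition tjurina_ideal :: "local_ring \<Rightarrow> local_ring set" where
  "tjurina_ideal g = {a * g + b * deriv_U g + c * deriv_V g | a b c. True}"

(* The residue classes of the elements of B are pairwise distinct and form a basis of the
   complex vector space C[[U,V]] / I. *)
definition quotient_basis :: "local_ring set \<Rightarrow> local_ring set \<Rightarrow> bool" where
  "quotient_basis I B \<longleftrightarrow>
     finite B \<and>
     (\<forall>h. \<exists>!c. (\<forall>b. b \<notin> B \<longrightarrow> c b = 0) \<and> h - (\<Sum>b\<in>B. emb (c b) * b) \<in> I)"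

(* Only meaningful when the quotient is finite dimensional, as it is at every point of a
   reduced curve. *)
definition quotient_dim :: "local_ring set \<Rightarrow> nat" where
  "quotient_dim I = card (SOME B. quotient_basis I B)"

definition tjurina_at :: "S \<Rightarrow> (complex ^ 3) set \<Rightarrow> nat" where
  "tjurina_at f p = quotient_dim (tjurina_ideal (local_eq f p))"

definition tjurina :: "S \<Rightarrow> nat" where
  "tjurina f = (\<Sum>p\<in>singular_points f. tjurina_at f p)"

definition tau_min :: "nat \<Rightarrow> nat \<Rightarrow> int" where
  "tau_min d r = (int d - 1) * (int d - int r - 1)"

end

theory Submission
  imports Defs
begin

text \<open>Let the arrangement have d lines, let n(p) be the number of lines through p, and let
\<open>\<sigma>\<close> be the sum of the numbers \<open>n(p) - 1\<close> over the multiple points.  Counting ordered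
pairs of distinct lines by their intersection points gives
\<open>\<Sum> n(p) (n(p) - 1) = d (d - 1)\<close>, hence \<open>\<Sum> (n(p) - 1)\<^sup>2 = d (d - 1) - \<sigma>\<close>.  With
\<open>s = r + 1\<close>, the theorem therefore follows from the upper bound
\<open>2 \<sigma> \<le> 2 d s - s (s + 1) - 2\<close>, which is better than required by \<open>r - 3\<close>.

The upper bound comes from a syzygy of degree r, where \<open>s \<le> d\<close> because of the Koszul
syzygies.  View it as a vector field D; since D annihilates the product of the linear forms,
it is tangent to each line.  So the vector-valued form \<open>\<omega>(v) = v \<times> D(v)\<close> of degree s is, on the plane \<open>n \<cdot> v = 0\<close> over a
line with normal vector n, a multiple of n.  At a point on two of the lines it is a multiple
of two independent vectors and therefore vanishes.  Two cases occur
(\<open>excess_le_of_tangent_form\<close>).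

If \<open>\<omega>\<close> vanishes identically on none of the lines, then each line carries at most s multiple
points (\<open>crossings_le_degree\<close>).  Adding a line to a family raises \<open>\<sigma>\<close> by the number of
points in which the line meets the family, so the line added to j others contributes at most
\<open>min j s\<close>, and the sum of these numbers is \<open>d s - s (s + 1) / 2\<close>.  Three concurrent lines
placed first contribute one less, provided that \<open>s \<ge> 2\<close>; this holds if there are two points of
multiplicity at least three, since some line then carries two multiple points.

If \<open>\<omega>\<close> vanishes on a line, it is divisible by the linear form of that line, and the quotient,
of degree \<open>s - 1\<close>, is tangent to the other \<open>d - 1\<close> lines.  Removing the line lowers
\<open>\<sigma>\<close> by at most \<open>d - 1\<close>, which is precisely the difference between the two bounds.
Here the saving of one needs two points of multiplicity at least three: if the removed line
passes through one of them, it meets the other lines in at most \<open>d - 2\<close> points, and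
otherwise both points survive in the smaller arrangement.

For the Tjurina numbers the inequality \<open>(n(p) - 1)\<^sup>2 \<le> \<tau>\<^sub>p\<close> suffices.  With
\<open>n = n(p)\<close> and \<open>k = n - 1\<close>, the Tjurina ideal at p lies in an ideal (P, Q) generated by two
series of order k, because the n lines through p have a homogeneous equation, to which
Euler's identity applies.  Modulo the power \<open>2 k\<close> of the maximal ideal, (P, Q) has dimension
at most \<open>k (k + 1)\<close> in a space of dimension \<open>k (2 k + 1)\<close> (\<open>card_spanning_ge\<close>).  That the
Tjurina algebra has a finite basis at all follows because the Tjurina ideal contains a power
of the maximal ideal (\<open>tjurina_ideal_contains_vanishing\<close>).\<close>

section \<open>Polynomials, substitution and formal partial derivatives\<close>

lemma single_sum_keys:
  fixes f :: S
  shows "(\<Sum>m\<in>Poly_Mapping.keys f. Poly_Mapping.single m (Poly_Mapping.lookup f m)) = f"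
proof (rule poly_mapping_eqI)
  fix k
  show "Poly_Mapping.lookup (\<Sum>m\<in>Poly_Mapping.keys f.
          Poly_Mapping.single m (Poly_Mapping.lookup f m)) k = Poly_Mapping.lookup f k"
    by (cases "k \<in> Poly_Mapping.keys f")
       (auto simp: lookup_sum lookup_single when_def in_keys_iff)
qed

lemma S_induct [case_names single add]:
  fixes f :: S
  assumes single: "\<And>m c. P (Poly_Mapping.single m c)"
    and add: "\<And>f g. P f \<Longrightarrow> P g \<Longrightarrow> P (f + g)"
  shows "P f"
proof -
  have "P (\<Sum>m\<in>X. Poly_Mapping.single m (Poly_Mapping.lookup f m))" if "finite X" for X
    using that
  proof (induction X)
    case empty
    show ?case using single[of 0 0] by simp
  next
    case (insert x F)
    thus ?case by (simp add: add single)
  qed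
  from this[of "Poly_Mapping.keys f"] show ?thesis
    by (simp add: single_sum_keys)
qed

definition ring_hom_from_complex :: "(complex \<Rightarrow> 'r::comm_ring_1) \<Rightarrow> bool" where
  "ring_hom_from_complex e \<longleftrightarrow>
     e 0 = 0 \<and> e 1 = 1 \<and> (\<forall>x y. e (x + y) = e x + e y) \<and> (\<forall>x y. e (x * y) = e x * e y)"

lemma subst_superset:
  assumes "ring_hom_from_complex e" "finite X" "Poly_Mapping.keys f \<subseteq> X"
  shows "subst e a f = (\<Sum>m\<in>X. e (Poly_Mapping.lookup f m) * (\<Prod>i\<in>UNIV. a i ^ Poly_Mapping.lookup m i))"
  unfolding subst_def
  by (rule sum.mono_neutral_left)
     (use assms in \<open>auto simp: ring_hom_from_complex_def in_keys_iff\<close>)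

lemma subst_add:
  assumes e: "ring_hom_from_complex e"
  shows "subst e a (f + g) = subst e a f + subst e a g"
proof -
  let ?X = "Poly_Mapping.keys f \<union> Poly_Mapping.keys g"
  have 1: "subst e a (f + g) =
      (\<Sum>m\<in>?X. e (Poly_Mapping.lookup (f + g) m) * (\<Prod>i\<in>UNIV. a i ^ Poly_Mapping.lookup m i))"
    by (rule subst_superset[OF e]) (auto simp: keys_add)
  have 2: "subst e a f =
      (\<Sum>m\<in>?X. e (Poly_Mapping.lookup f m) * (\<Prod>i\<in>UNIV. a i ^ Poly_Mapping.lookup m i))"
    "subst e a g =
      (\<Sum>m\<in>?X. e (Poly_Mapping.lookup g m) * (\<Prod>i\<in>UNIV. a i ^ Poly_Mapping.lookup m i))"
    by (rule subst_superset[OF e]; auto)+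
  show ?thesis
    unfolding 1 2 sum.distrib[symmetric]
    by (rule sum.cong) (use e in \<open>auto simp: ring_hom_from_complex_def lookup_add algebra_simps\<close>)
qed

lemma subst_single:
  assumes e: "ring_hom_from_complex e"
  shows "subst e a (Poly_Mapping.single m c) = e c * (\<Prod>i\<in>UNIV. a i ^ Poly_Mapping.lookup m i)"
  by (subst subst_superset[OF e, where X = "{m}"]) auto

lemma subst_0 [simp]: "subst e a 0 = 0"
  by (simp add: subst_def)

lemma subst_1:
  assumes e: "ring_hom_from_complex e"
  shows "subst e a 1 = 1"
  using subst_single[OF e, of a 0 1] e
  by (simp add: ring_hom_from_complex_def single_one)

lemma subst_mult:
  assumes e: "ring_hom_from_complex e"
  shows "subst e a (f * g) = subst e a f * subst e a g"
proof (induction f rule: S_induct)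
  case (single m c)
  show ?case
  proof (induction g rule: S_induct)
    case (single m' c')
    show ?case using e
      by (simp add: mult_single subst_single lookup_add power_add prod.distrib
            ring_hom_from_complex_def)
  next
    case (add f g)
    thus ?case by (simp add: distrib_left subst_add[OF e])
  qed
next
  case (add f f')
  thus ?case by (simp add: distrib_right subst_add[OF e])
qed

lemma subst_prod:
  assumes e: "ring_hom_from_complex e"
  shows "subst e a (\<Prod>x\<in>X. F x) = (\<Prod>x\<in>X. subst e a (F x))"
  by (induction X rule: infinite_finite_induct) (simp_all add: subst_1[OF e] subst_mult[OF e])

lemma ring_hom_id: "ring_hom_from_complex (\<lambda>c. c)"
  by (simp add: ring_hom_from_complex_def)

lemmas eval_add = subst_add[OF ring_hom_id, of "vec_nth v" for v, folded eval_def]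
lemmas eval_mult = subst_mult[OF ring_hom_id, of "vec_nth v" for v, folded eval_def]
lemmas eval_prod = subst_prod[OF ring_hom_id, of "vec_nth v" for v, folded eval_def]
lemmas eval_single = subst_single[OF ring_hom_id, of "vec_nth v" for v, folded eval_def]

lemma eval_0 [simp]: "eval 0 v = 0"
  by (simp add: eval_def)

lemma eval_sum: "eval (\<Sum>x\<in>X. F x) v = (\<Sum>x\<in>X. eval (F x) v)"
  by (induction X rule: infinite_finite_induct) (simp_all add: eval_add)

lemma pdiff_superset:
  assumes "finite X" "Poly_Mapping.keys f \<subseteq> X"
  shows "pdiff i f = (\<Sum>m\<in>X. Poly_Mapping.single (m - Poly_Mapping.single i 1)
       (of_nat (Poly_Mapping.lookup m i) * Poly_Mapping.lookup f m))"
  unfolding pdiff_def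
  by (rule sum.mono_neutral_left) (use assms in \<open>auto simp: in_keys_iff\<close>)

lemma pdiff_single:
  "pdiff i (Poly_Mapping.single m c) =
     Poly_Mapping.single (m - Poly_Mapping.single i 1) (of_nat (Poly_Mapping.lookup m i) * c)"
  by (subst pdiff_superset[where X = "{m}"]) auto

lemma pdiff_add: "pdiff i (f + g) = pdiff i f + pdiff i g"
proof -
  let ?X = "Poly_Mapping.keys f \<union> Poly_Mapping.keys g"
  have 1: "pdiff i h = (\<Sum>m\<in>?X. Poly_Mapping.single (m - Poly_Mapping.single i 1)
       (of_nat (Poly_Mapping.lookup m i) * Poly_Mapping.lookup h m))"
    if "Poly_Mapping.keys h \<subseteq> ?X" for h
    by (rule pdiff_superset) (use that in auto)
  show ?thesis
    using 1[of f] 1[of g] 1[of "f + g"] keys_add[of f g]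
    by (simp add: sum.distrib[symmetric] single_add[symmetric] lookup_add algebra_simps)
qed

lemma pdiff_mult_single:
  "pdiff i (Poly_Mapping.single m c * Poly_Mapping.single m' c') =
     pdiff i (Poly_Mapping.single m c) * Poly_Mapping.single m' c'
     + Poly_Mapping.single m c * pdiff i (Poly_Mapping.single m' c')"
proof -
  let ?e = "Poly_Mapping.single i (1::nat)"
  have shift: "(x - ?e) + y = (x + y) - ?e" if "Poly_Mapping.lookup x i > 0" for x y
    using that by (intro poly_mapping_eqI) (auto simp: lookup_add lookup_minus lookup_single when_def)
  have 1: "Poly_Mapping.single ((m - ?e) + m') (of_nat (Poly_Mapping.lookup m i) * c * c') =
      Poly_Mapping.single (m + m' - ?e) (of_nat (Poly_Mapping.lookup m i) * c * c')"
    using shift[of m m'] by (cases "Poly_Mapping.lookup m i = 0") (simp_all del: One_nat_def)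
  have 2: "Poly_Mapping.single (m + (m' - ?e)) (c * (of_nat (Poly_Mapping.lookup m' i) * c')) =
      Poly_Mapping.single (m + m' - ?e) (c * (of_nat (Poly_Mapping.lookup m' i) * c'))"
    using shift[of m' m]
    by (cases "Poly_Mapping.lookup m' i = 0") (simp_all add: add.commute del: One_nat_def)
  show ?thesis
    unfolding mult_single pdiff_single 1 2
    by (simp add: single_add[symmetric] lookup_add algebra_simps)
qed

lemma pdiff_mult: "pdiff i (f * g) = pdiff i f * g + f * pdiff i g"
proof (induction f rule: S_induct)
  case (single m c)
  show ?case
  proof (induction g rule: S_induct)
    case (single m' c')
    show ?case by (rule pdiff_mult_single)
  next
    case (add f g)
    thus ?case by (simp add: distrib_left pdiff_add)
  qed
next
  case (add f f')
  thus ?case by (simp add: distrib_right pdiff_add)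
qed

lemma pdiff_1 [simp]: "pdiff i 1 = 0"
  using pdiff_single[of i 0 1] by (simp add: single_one)

lemma pdiff_prod:
  "finite X \<Longrightarrow> pdiff i (\<Prod>x\<in>X. F x) = (\<Sum>x\<in>X. pdiff i (F x) * (\<Prod>y\<in>X - {x}. F y))"
proof (induction X rule: finite_induct)
  case (insert x X)
  have "(\<Sum>z\<in>X. pdiff i (F z) * (\<Prod>y\<in>insert x X - {z}. F y)) =
        (\<Sum>z\<in>X. F x * (pdiff i (F z) * (\<Prod>y\<in>X - {z}. F y)))"
  proof (rule sum.cong[OF refl])
    fix z assume z: "z \<in> X"
    hence "insert x X - {z} = insert x (X - {z})" using insert.hyps by auto
    thus "pdiff i (F z) * (\<Prod>y\<in>insert x X - {z}. F y) =
          F x * (pdiff i (F z) * (\<Prod>y\<in>X - {z}. F y))"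
      using insert.hyps by (simp add: mult.left_commute)
  qed
  thus ?case using insert.hyps insert.IH
    by (simp add: pdiff_mult sum_distrib_left algebra_simps)
qed simp

lemma homogeneous_0 [simp]: "homogeneous q 0"
  by (simp add: homogeneous_def)

lemma homogeneous_1: "homogeneous 0 1"
  by (simp add: homogeneous_def flip: single_one)

lemma homogeneous_add: "homogeneous q f \<Longrightarrow> homogeneous q g \<Longrightarrow> homogeneous q (f + g)"
  unfolding homogeneous_def using keys_add[of f g] by blast

lemma homogeneous_uminus: "homogeneous q f \<Longrightarrow> homogeneous q (- f)"
  by (simp add: homogeneous_def in_keys_iff)

lemma homogeneous_mult:
  assumes "homogeneous p f" "homogeneous q g"
  shows "homogeneous (p + q) (f * g)"
  unfolding homogeneous_def
proof
  fix m assume "m \<in> Poly_Mapping.keys (f * g)"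
  then obtain a b where "a \<in> Poly_Mapping.keys f" "b \<in> Poly_Mapping.keys g" "m = a + b"
    using keys_mult[of f g] by blast
  thus "(\<Sum>i\<in>UNIV. Poly_Mapping.lookup m i) = p + q"
    using assms by (auto simp: homogeneous_def lookup_add sum.distrib)
qed

lemma homogeneous_sum: "(\<And>x. x \<in> X \<Longrightarrow> homogeneous q (F x)) \<Longrightarrow> homogeneous q (\<Sum>x\<in>X. F x)"
  by (induction X rule: infinite_finite_induct) (auto intro: homogeneous_add)

lemma homogeneous_pdiff:
  assumes "homogeneous (Suc q) f"
  shows "homogeneous q (pdiff i f)"
  unfolding pdiff_def
proof (rule homogeneous_sum)
  fix m assume m: "m \<in> Poly_Mapping.keys f"
  let ?e = "Poly_Mapping.single i (1::nat)"
  show "homogeneous q (Poly_Mapping.single (m - ?e)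
          (of_nat (Poly_Mapping.lookup m i) * Poly_Mapping.lookup f m))"
  proof (cases "Poly_Mapping.lookup m i = 0")
    case False
    have "m = (m - ?e) + ?e"
      using False by (intro poly_mapping_eqI) (auto simp: lookup_add lookup_minus lookup_single when_def)
    hence "(\<Sum>j\<in>UNIV. Poly_Mapping.lookup m j) =
        (\<Sum>j\<in>UNIV. Poly_Mapping.lookup (m - ?e) j) + (\<Sum>j\<in>UNIV. Poly_Mapping.lookup ?e j)"
      by (metis (no_types, lifting) lookup_add sum.cong sum.distrib)
    moreover have "(\<Sum>j\<in>UNIV. Poly_Mapping.lookup ?e j) = 1"
      by (simp add: lookup_single when_def)
    ultimately have "(\<Sum>j\<in>UNIV. Poly_Mapping.lookup (m - ?e) j) = q"
      using assms m by (simp add: homogeneous_def)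
    thus ?thesis by (auto simp: homogeneous_def)
  qed auto
qed

lemma homogeneous_prod:
  assumes "finite X" "\<And>x. x \<in> X \<Longrightarrow> homogeneous 1 (F x)"
  shows "homogeneous (card X) (\<Prod>x\<in>X. F x)"
  using assms
proof (induction X rule: finite_induct)
  case (insert x X)
  thus ?case using homogeneous_mult[of 1 "F x" "card X" "\<Prod>x\<in>X. F x"] by simp
qed (simp add: homogeneous_1)

lemma homogeneous_1_expand:
  assumes "homogeneous 1 l"
  shows "l = (\<Sum>i\<in>UNIV. Poly_Mapping.single (Poly_Mapping.single i 1)
              (Poly_Mapping.lookup l (Poly_Mapping.single i 1)))"
proof -
  let ?e = "\<lambda>i::3. Poly_Mapping.single i (1::nat)"
  have key: "m \<in> range ?e" if "m \<in> Poly_Mapping.keys l" for m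
  proof -
    have s: "(\<Sum>i\<in>UNIV. Poly_Mapping.lookup m i) = 1"
      using assms that by (auto simp: homogeneous_def)
    then obtain i where i: "Poly_Mapping.lookup m i \<noteq> 0"
      by (metis one_neq_zero sum.neutral)
    have "(\<Sum>j\<in>UNIV. Poly_Mapping.lookup m j) =
        Poly_Mapping.lookup m i + (\<Sum>j\<in>UNIV - {i}. Poly_Mapping.lookup m j)"
      by (rule sum.remove) auto
    hence 0: "(\<Sum>j\<in>UNIV - {i}. Poly_Mapping.lookup m j) = 0" and "Poly_Mapping.lookup m i = 1"
      using s i by linarith+
    moreover have "Poly_Mapping.lookup m j = 0" if "j \<noteq> i" for j
      using 0 that by simp
    ultimately have "m = ?e i"
      by (intro poly_mapping_eqI) (auto simp: lookup_single when_def)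
    thus ?thesis by blast
  qed
  have inj: "inj ?e"
    by (metis (no_types, lifting) inj_onI lookup_single_eq lookup_single_not_eq one_neq_zero)
  have "l = (\<Sum>m\<in>Poly_Mapping.keys l. Poly_Mapping.single m (Poly_Mapping.lookup l m))"
    by (simp add: single_sum_keys)
  also have "\<dots> = (\<Sum>m\<in>range ?e. Poly_Mapping.single m (Poly_Mapping.lookup l m))"
    by (rule sum.mono_neutral_left) (use key in \<open>auto simp: in_keys_iff\<close>)
  also have "\<dots> = (\<Sum>i\<in>UNIV. Poly_Mapping.single (?e i) (Poly_Mapping.lookup l (?e i)))"
    by (rule sum.reindex_cong[OF inj]) auto
  finally show ?thesis .
qed

text \<open>The line \<open>l = 0\<close> is the set of v with \<open>dot (normal_vec l) v = 0\<close>.  The pairing is bilinear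
  rather than Hermitian, so that it is polynomial in v.\<close>

definition normal_vec :: "S \<Rightarrow> complex ^ 3" where
  "normal_vec l = (\<chi> i. Poly_Mapping.lookup l (Poly_Mapping.single i 1))"

definition dot :: "complex ^ 3 \<Rightarrow> complex ^ 3 \<Rightarrow> complex" where
  "dot n v = (\<Sum>i\<in>UNIV. n $ i * v $ i)"

lemma prod_pow_single:
  fixes a :: "3 \<Rightarrow> 'r::comm_ring_1"
  shows "(\<Prod>j\<in>UNIV. a j ^ Poly_Mapping.lookup (Poly_Mapping.single i (1::nat)) j) = a i"
proof -
  have "(\<Prod>j\<in>UNIV. a j ^ Poly_Mapping.lookup (Poly_Mapping.single i (1::nat)) j) =
      (\<Prod>j\<in>UNIV. if j = i then a j else 1)"
    by (rule prod.cong) (auto simp: lookup_single when_def)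
  thus ?thesis by simp
qed

lemma subst_sum:
  assumes e: "ring_hom_from_complex e"
  shows "subst e a (\<Sum>x\<in>X. F x) = (\<Sum>x\<in>X. subst e a (F x))"
  by (induction X rule: infinite_finite_induct) (simp_all add: subst_add[OF e])

lemma subst_linear:
  assumes e: "ring_hom_from_complex e" and l: "homogeneous 1 l"
  shows "subst e a l = (\<Sum>i\<in>UNIV. e (normal_vec l $ i) * a i)"
  by (subst homogeneous_1_expand[OF l])
     (simp add: subst_sum[OF e] subst_single[OF e] prod_pow_single normal_vec_def del: One_nat_def)

lemma eval_linear: "homogeneous 1 l \<Longrightarrow> eval l v = dot (normal_vec l) v"
  by (simp add: eval_def subst_linear[OF ring_hom_id] dot_def)

lemma eval_pdiff_linear:
  assumes l: "homogeneous 1 l"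
  shows "eval (pdiff i l) v = normal_vec l $ i"
proof -
  have p0: "pdiff i 0 = 0" by (simp add: pdiff_def)
  have ps: "pdiff i (\<Sum>x\<in>X. F x) = (\<Sum>x\<in>X. pdiff i (F x))" for X :: "3 set" and F
    by (induction X rule: infinite_finite_induct) (simp_all add: pdiff_add p0)
  have t: "eval (pdiff i (Poly_Mapping.single (Poly_Mapping.single j 1) c)) v = (if j = i then c else 0)"
    for j c
    by (auto simp: pdiff_single eval_single lookup_single when_def)
  show ?thesis
    by (subst homogeneous_1_expand[OF l])
       (simp add: ps eval_sum t normal_vec_def del: One_nat_def)
qed

lemma normal_vec_inject_scaled:
  assumes "homogeneous 1 l" "homogeneous 1 l'" "normal_vec l' = c *s normal_vec l"
  shows "l' = const c * l"
proof -
  have c: "Poly_Mapping.lookup l' (Poly_Mapping.single i 1) = c * Poly_Mapping.lookup l (Poly_Mapping.single i 1)"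
    for i using assms(3) by (simp add: normal_vec_def vec_eq_iff del: One_nat_def)
  have "const c * l = (\<Sum>i\<in>UNIV. const c * Poly_Mapping.single (Poly_Mapping.single i 1)
              (Poly_Mapping.lookup l (Poly_Mapping.single i 1)))"
    by (subst homogeneous_1_expand[OF assms(1)]) (simp add: sum_distrib_left del: One_nat_def)
  also have "\<dots> = (\<Sum>i\<in>UNIV. Poly_Mapping.single (Poly_Mapping.single i 1)
              (Poly_Mapping.lookup l' (Poly_Mapping.single i 1)))"
    by (simp add: const_def mult_single c del: One_nat_def)
  also have "\<dots> = l'"
    by (rule homogeneous_1_expand[OF assms(2), symmetric])
  finally show ?thesis by simp
qed

section \<open>Counting incidences in families of pairwise crossing lines\<close>

text \<open>The counting uses nothing about lines except that two of them meet in exactly one point.\<close>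

definition linear_family :: "('l \<Rightarrow> 'p set) \<Rightarrow> 'l set \<Rightarrow> bool" where
  "linear_family pts A \<longleftrightarrow>
     finite A \<and> (\<forall>l\<in>A. \<forall>m\<in>A. l \<noteq> m \<longrightarrow> (\<exists>p. pts l \<inter> pts m = {p}))"

definition deg :: "('l \<Rightarrow> 'p set) \<Rightarrow> 'l set \<Rightarrow> 'p \<Rightarrow> nat" where
  "deg pts A p = card {l \<in> A. p \<in> pts l}"

definition multiple :: "('l \<Rightarrow> 'p set) \<Rightarrow> 'l set \<Rightarrow> 'p set" where
  "multiple pts A = {p. 2 \<le> deg pts A p}"

text \<open>The number that complements \<open>\<Sum> (n(p) - 1)\<^sup>2\<close> to \<open>d (d - 1)\<close>, see
  \<open>sum_squares_plus_excess\<close>; it is also the number that changes in the simplest way when a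
  line is added, see \<open>excess_insert\<close>.\<close>

definition excess :: "('l \<Rightarrow> 'p set) \<Rightarrow> 'l set \<Rightarrow> nat" where
  "excess pts A = (\<Sum>p\<in>multiple pts A. deg pts A p - 1)"

definition crossings :: "('l \<Rightarrow> 'p set) \<Rightarrow> 'l set \<Rightarrow> 'l \<Rightarrow> 'p set" where
  "crossings pts A l = pts l \<inter> (\<Union>m\<in>A - {l}. pts m)"

lemma linear_family_subset: "linear_family pts A \<Longrightarrow> B \<subseteq> A \<Longrightarrow> linear_family pts B"
  unfolding linear_family_def by (meson finite_subset subsetD)

lemma linear_family_meet:
  assumes "linear_family pts A" "l \<in> A" "m \<in> A" "l \<noteq> m"
  obtains p where "pts l \<inter> pts m = {p}"
  using assms unfolding linear_family_def by meson

lemma card_crossings_le: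
  assumes "linear_family pts A" "l \<in> A" "B \<subseteq> A - {l}"
    and "crossings pts A l \<subseteq> (\<Union>m\<in>B. pts m)"
  shows "finite (crossings pts A l)" "card (crossings pts A l) \<le> card B"
proof -
  have finB: "finite B"
    using assms by (meson finite_Diff finite_subset linear_family_def)
  have "\<forall>m\<in>B. \<exists>p. pts l \<inter> pts m = {p}"
    using assms by (metis DiffD1 DiffD2 insertI1 linear_family_meet subsetD)
  then obtain p where p: "\<And>m. m \<in> B \<Longrightarrow> pts l \<inter> pts m = {p m}" by metis
  have sub: "crossings pts A l \<subseteq> p ` B"
  proof
    fix x assume x: "x \<in> crossings pts A l"
    then obtain m where "m \<in> B" "x \<in> pts m" using assms(4) by blast
    moreover have "x \<in> pts l" using x by (simp add: crossings_def)
    ultimately show "x \<in> p ` B" using p[of m] by blast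
  qed
  show "finite (crossings pts A l)" using sub finB by (meson finite_imageI finite_subset)
  show "card (crossings pts A l) \<le> card B"
    using sub finB by (meson card_image_le card_mono finite_imageI order_trans)
qed

lemma card_crossings_le_others:
  assumes "linear_family pts A" "l \<in> A"
  shows "finite (crossings pts A l)" "card (crossings pts A l) \<le> card A - 1"
proof -
  have "crossings pts A l \<subseteq> (\<Union>m\<in>A - {l}. pts m)" by (auto simp: crossings_def)
  from card_crossings_le[OF assms order_refl this]
  show "finite (crossings pts A l)" "card (crossings pts A l) \<le> card A - 1"
    using assms by auto
qed

text \<open>The two other lines through p cross l in the same point.\<close>

lemma card_crossings_le_triple:
  assumes A: "linear_family pts A" "l \<in> A" and p: "p \<in> pts l" "3 \<le> deg pts A p"
  shows "card (crossings pts A l) + 2 \<le> card A"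
proof -
  have finA: "finite A" using A by (simp add: linear_family_def)
  let ?T = "{m \<in> A. p \<in> pts m}"
  have "2 \<le> card (?T - {l})"
    using p A(2) finA by (simp add: deg_def)
  then obtain T where T: "T \<subseteq> ?T - {l}" "card T = 2"
    by (meson obtain_subset_with_card_n)
  then obtain m m' where m: "T = {m, m'}" "m \<noteq> m'" by (auto simp: card_2_iff)
  have pp: "p \<in> pts m" "p \<in> pts m'" "m \<in> A" "m' \<in> A" "m \<noteq> l" "m' \<noteq> l"
    using T(1) m by auto
  obtain x where "pts l \<inter> pts m = {x}"
    using linear_family_meet[OF A \<open>m \<in> A\<close>] pp by metis
  hence lm: "pts l \<inter> pts m = {p}" using p pp by auto
  have "crossings pts A l \<subseteq> (\<Union>k\<in>A - {l, m}. pts k)"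
  proof
    fix x assume x: "x \<in> crossings pts A l"
    then obtain k where k: "k \<in> A" "k \<noteq> l" "x \<in> pts k" "x \<in> pts l"
      by (auto simp: crossings_def)
    show "x \<in> (\<Union>k\<in>A - {l, m}. pts k)"
    proof (cases "k = m")
      case True
      hence "x = p" using k lm by blast
      thus ?thesis using pp m by blast
    qed (use k in auto)
  qed
  hence "card (crossings pts A l) \<le> card (A - {l, m})"
    by (intro card_crossings_le(2)[OF A]) auto
  moreover have "card (A - {l, m}) = card A - 2"
    using pp A(2) finA by (subst card_Diff_subset) auto
  moreover have "card {l, m, m'} \<le> card A"
    using pp A(2) finA by (intro card_mono) auto
  ultimately show ?thesis using pp m by auto
qed

lemma deg_insert:
  assumes "finite A" "l \<notin> A"
  shows "deg pts (insert l A) p = deg pts A p + (if p \<in> pts l then 1 else 0)"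
proof -
  have "{m \<in> insert l A. p \<in> pts m} =
      (if p \<in> pts l then insert l {m \<in> A. p \<in> pts m} else {m \<in> A. p \<in> pts m})" by auto
  thus ?thesis using assms by (simp add: deg_def)
qed

lemma finite_multiple:
  assumes "linear_family pts A"
  shows "finite (multiple pts A)"
proof (rule finite_subset)
  show "multiple pts A \<subseteq> (\<Union>l\<in>A. crossings pts A l)"
  proof
    fix p assume "p \<in> multiple pts A"
    hence "2 \<le> card {l \<in> A. p \<in> pts l}" by (simp add: multiple_def deg_def)
    then obtain T where T: "T \<subseteq> {l \<in> A. p \<in> pts l}" "card T = 2"
      by (meson obtain_subset_with_card_n)
    then obtain l m where "T = {l, m}" "l \<noteq> m" by (auto simp: card_2_iff)
    thus "p \<in> (\<Union>l\<in>A. crossings pts A l)" using T by (auto simp: crossings_def)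
  qed
  show "finite (\<Union>l\<in>A. crossings pts A l)"
    using assms card_crossings_le_others(1)[OF assms] by (auto simp: linear_family_def)
qed

text \<open>The new line raises the multiplicity of each of its points by one.  This changes
  \<open>n(p) - 1\<close> exactly at those points through which an old line passes.\<close>

lemma excess_insert:
  assumes A: "linear_family pts (insert l A)" and l: "l \<notin> A"
  shows "excess pts (insert l A) = excess pts A + card (crossings pts (insert l A) l)"
proof -
  let ?X = "multiple pts (insert l A)" and ?C = "crossings pts (insert l A) l"
  have finA: "finite A" using A by (simp add: linear_family_def)
  note d = deg_insert[OF finA l, of pts]
  have finX: "finite ?X" by (rule finite_multiple[OF A])
  have deg_pos: "deg pts A p \<ge> 1 \<longleftrightarrow> (\<exists>m\<in>A. p \<in> pts m)" for p
    using finA by (auto simp: deg_def card_gt_0_iff Suc_le_eq)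
  have C: "p \<in> ?C \<longleftrightarrow> p \<in> pts l \<and> deg pts A p \<ge> 1" for p
    unfolding deg_pos using l by (auto simp: crossings_def)
  have CX: "?C \<subseteq> ?X" using C by (auto simp: multiple_def d)
  have "excess pts A = (\<Sum>p\<in>?X. deg pts A p - 1)"
    unfolding excess_def
    by (rule sum.mono_neutral_left) (use finX in \<open>auto simp: multiple_def d\<close>)
  moreover have "card ?C = (\<Sum>p\<in>?X. if p \<in> ?C then 1 else 0)"
    using CX finX by (simp add: sum.If_cases Int_absorb1)
  moreover have "excess pts (insert l A) =
      (\<Sum>p\<in>?X. (deg pts A p - 1) + (if p \<in> ?C then 1 else 0))"
    unfolding excess_def
    by (rule sum.cong[OF refl]) (auto simp: C d multiple_def)
  ultimately show ?thesis by (simp add: sum.distrib)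
qed

lemma excess_remove:
  assumes "linear_family pts A" "l \<in> A"
  shows "excess pts A = excess pts (A - {l}) + card (crossings pts A l)"
  using excess_insert[of pts l "A - {l}"] assms by (simp add: insert_absorb)

lemma card_ordered_pairs:
  assumes "finite X"
  shows "card {(x, y). x \<in> X \<and> y \<in> X \<and> x \<noteq> y} = card X * (card X - 1)"
proof -
  have "{(x, y). x \<in> X \<and> y \<in> X \<and> x \<noteq> y} = (SIGMA x:X. X - {x})" by auto
  thus ?thesis using assms by simp
qed

text \<open>Every ordered pair of distinct lines meets in exactly one multiple point, and
  \<open>(n - 1)\<^sup>2 + (n - 1) = n (n - 1)\<close>.\<close>

lemma sum_squares_plus_excess:
  fixes pts :: "'l \<Rightarrow> 'p set"
  assumes A: "linear_family pts A"
  shows "(\<Sum>p\<in>multiple pts A. (deg pts A p - 1)\<^sup>2) + excess pts A = card A * (card A - 1)"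
proof -
  let ?P = "\<lambda>X. {(x, y). x \<in> X \<and> y \<in> X \<and> x \<noteq> y}"
  let ?L = "\<lambda>p. {l \<in> A. p \<in> pts l}"
  have finA: "finite A" using A by (simp add: linear_family_def)
  have fin: "finite (?P (?L p))" for p
    by (rule finite_subset[of _ "A \<times> A"]) (use finA in auto)
  have "?P A = (\<Union>p\<in>multiple pts A. ?P (?L p))" (is "_ = ?R")
  proof
    show "?P A \<subseteq> ?R"
    proof clarsimp
      fix l m assume lm: "l \<in> A" "m \<in> A" "l \<noteq> m"
      then obtain p where p: "pts l \<inter> pts m = {p}" using linear_family_meet[OF A] by metis
      have "card {l, m} \<le> card (?L p)"
        using finA lm p by (intro card_mono) auto
      hence "p \<in> multiple pts A" using lm by (simp add: multiple_def deg_def)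
      thus "\<exists>p\<in>multiple pts A. p \<in> pts l \<and> p \<in> pts m" using p by auto
    qed
  qed auto
  moreover have "card ?R = (\<Sum>p\<in>multiple pts A. card (?P (?L p)))"
  proof (rule card_UN_disjoint[OF finite_multiple[OF A]])
    show "\<forall>p\<in>multiple pts A. \<forall>q\<in>multiple pts A. p \<noteq> q \<longrightarrow> ?P (?L p) \<inter> ?P (?L q) = {}"
    proof (intro ballI impI)
      fix p q :: 'p assume "p \<noteq> q"
      have False if "x \<in> A" "y \<in> A" "x \<noteq> y" "p \<in> pts x" "p \<in> pts y" "q \<in> pts x" "q \<in> pts y" for x y
      proof -
        obtain z where "pts x \<inter> pts y = {z}" using linear_family_meet[OF A] \<open>x \<in> A\<close> \<open>y \<in> A\<close> \<open>x \<noteq> y\<close> by metis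
        hence "p \<in> {z}" "q \<in> {z}" using that(4-7) by (metis IntI)+
        thus False using \<open>p \<noteq> q\<close> by simp
      qed
      thus "?P (?L p) \<inter> ?P (?L q) = {}" by blast
    qed
  qed (use fin in blast)
  moreover have "card (?P (?L p)) = deg pts A p * (deg pts A p - 1)" for p
    using card_ordered_pairs[of "?L p"] finA by (simp add: deg_def)
  ultimately have "card A * (card A - 1) = (\<Sum>p\<in>multiple pts A. deg pts A p * (deg pts A p - 1))"
    by (simp only: card_ordered_pairs[OF finA, symmetric])
  also have "\<dots> = (\<Sum>p\<in>multiple pts A. (deg pts A p - 1)\<^sup>2 + (deg pts A p - 1))"
  proof (rule sum.cong[OF refl])
    fix p
    show "deg pts A p * (deg pts A p - 1) = (deg pts A p - 1)\<^sup>2 + (deg pts A p - 1)"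
      by (cases "deg pts A p") (simp_all add: power2_eq_square)
  qed
  finally show ?thesis by (simp add: sum.distrib excess_def)
qed

lemma crossings_mono: "B \<subseteq> A \<Longrightarrow> crossings pts B l \<subseteq> crossings pts A l"
  by (auto simp: crossings_def)

lemma card_crossings_subfamily:
  assumes A: "linear_family pts A" and s: "\<And>l. l \<in> A \<Longrightarrow> card (crossings pts A l) \<le> s"
    and B: "B \<subseteq> A" "l \<in> B"
  shows "card (crossings pts B l) \<le> min (card B - 1) s"
proof -
  have "card (crossings pts B l) \<le> card (crossings pts A l)"
    using B crossings_mono[OF B(1)] card_crossings_le_others(1)[OF A, of l]
    by (meson card_mono subsetD)
  moreover have "card (crossings pts B l) \<le> card B - 1"
    by (rule card_crossings_le_others(2)[OF linear_family_subset[OF A B(1)] B(2)])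
  ultimately show ?thesis using s[of l] B by auto
qed

text \<open>The lines outside T are added one at a time; the one added to j others crosses them in at most
  \<open>min j s\<close> points.  The number e is a saving that the lines placed first already have.\<close>

lemma excess_le_sum_min:
  assumes A: "linear_family pts A" and s: "\<And>l. l \<in> A \<Longrightarrow> card (crossings pts A l) \<le> s"
    and C: "finite C" "C \<subseteq> A - T" and T: "T \<subseteq> A" "excess pts T + e \<le> (\<Sum>i<card T. min i s)"
  shows "excess pts (T \<union> C) + e \<le> (\<Sum>i<card (T \<union> C). min i s)"
  using C
proof (induction C rule: finite_induct)
  case empty
  thus ?case using T by simp
next
  case (insert x C)
  let ?B = "insert x (T \<union> C)"
  have x: "x \<notin> T \<union> C" and B: "?B \<subseteq> A" using insert T by auto
  have fin: "finite (T \<union> C)"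
    using A T insert.hyps by (meson finite_UnI finite_subset linear_family_def)
  have "excess pts ?B = excess pts (T \<union> C) + card (crossings pts ?B x)"
    by (rule excess_insert[OF linear_family_subset[OF A B] x])
  moreover have "card (crossings pts ?B x) \<le> min (card ?B - 1) s"
    by (rule card_crossings_subfamily[OF A s B]) auto
  hence "card (crossings pts ?B x) \<le> min (card (T \<union> C)) s" using x fin by (simp del: min.bounded_iff)
  moreover have "excess pts (T \<union> C) + e \<le> (\<Sum>i<card (T \<union> C). min i s)"
    using insert by blast
  moreover have "card ?B = Suc (card (T \<union> C))" using x fin by simp
  moreover have "T \<union> insert x C = ?B" by blast
  ultimately show ?case by (simp del: min.bounded_iff Un_insert_right)
qed

lemma sum_min_closed:
  fixes s d :: nat
  shows "s \<le> d \<Longrightarrow> 2 * (\<Sum>i<d. min i s) + s * (s + 1) = 2 * d * s"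
proof (induction d rule: dec_induct)
  case base
  have "(\<Sum>i<n. min i s) = (\<Sum>i<n. i)" if "n \<le> s" for n
    by (rule sum.cong) (use that in auto)
  moreover have "2 * (\<Sum>i<n. i) + n = n * n" for n :: nat
    by (induction n) auto
  from this[of s] show ?case by (simp add: calculation)
qed (simp add: algebra_simps)

lemma excess_bound:
  assumes A: "linear_family pts A" and s: "\<And>l. l \<in> A \<Longrightarrow> card (crossings pts A l) \<le> s"
    and d: "s \<le> card A"
  shows "2 * excess pts A + s * (s + 1) \<le> 2 * card A * s"
proof -
  have "excess pts A + 0 \<le> (\<Sum>i<card A. min i s)"
    using excess_le_sum_min[OF A s, of A "{}" 0] A
    by (simp add: excess_def multiple_def deg_def linear_family_def)
  thus ?thesis using sum_min_closed[OF d] by linarith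
qed

text \<open>Three concurrent lines have excess 2, whereas the bound for three lines is
  \<open>0 + 1 + 2\<close>; this saving persists when the other lines are added.\<close>

lemma excess_bound_triple:
  assumes A: "linear_family pts A" and s: "\<And>l. l \<in> A \<Longrightarrow> card (crossings pts A l) \<le> s"
    and d: "s \<le> card A" and p: "3 \<le> deg pts A p" and s2: "2 \<le> s"
  shows "2 * excess pts A + s * (s + 1) + 2 \<le> 2 * card A * s"
proof -
  have finA: "finite A" using A by (simp add: linear_family_def)
  obtain T where T: "T \<subseteq> {l \<in> A. p \<in> pts l}" "card T = 3"
    using p unfolding deg_def by (meson obtain_subset_with_card_n)
  have TA: "T \<subseteq> A" and finT: "finite T" using T finA by (auto intro: finite_subset)
  have linT: "linear_family pts T" by (rule linear_family_subset[OF A TA])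
  obtain l where l: "l \<in> T" using T by fastforce
  have "{l \<in> T. p \<in> pts l} = T" using T by auto
  hence "3 \<le> deg pts T p" using T by (simp add: deg_def)
  hence "card (crossings pts T l) \<le> 1"
    using card_crossings_le_triple[OF linT l, of p] T l by auto
  moreover have "excess pts (T - {l}) \<le> 1"
  proof -
    have "excess pts ({} \<union> (T - {l})) + 0 \<le> (\<Sum>i<card ({} \<union> (T - {l})). min i s)"
      by (rule excess_le_sum_min[OF A s])
         (use TA finT in \<open>auto simp: excess_def multiple_def deg_def\<close>)
    thus ?thesis using T l finT s2 by (simp add: numeral_2_eq_2)
  qed
  moreover have "excess pts T = excess pts (T - {l}) + card (crossings pts T l)"
    by (rule excess_remove[OF linT l])
  ultimately have "excess pts T + 1 \<le> 3" by simp
  also have "3 = (\<Sum>i<card T. min i s)" using T s2 by (simp add: numeral_3_eq_3)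
  finally have "excess pts (T \<union> (A - T)) + 1 \<le> (\<Sum>i<card (T \<union> (A - T)). min i s)"
    by (intro excess_le_sum_min[OF A s]) (use TA finA in auto)
  moreover have "T \<union> (A - T) = A" using TA by auto
  ultimately show ?thesis using sum_min_closed[OF d] by simp
qed

lemma line_through_avoiding:
  assumes A: "linear_family pts A" and pq: "p \<noteq> q" "2 \<le> deg pts A p"
  obtains l where "l \<in> A" "p \<in> pts l" "q \<notin> pts l"
proof -
  obtain T where T: "T \<subseteq> {l \<in> A. p \<in> pts l}" "card T = 2"
    using pq(2) unfolding deg_def by (meson obtain_subset_with_card_n)
  then obtain l m where lm: "T = {l, m}" "l \<noteq> m" by (auto simp: card_2_iff)
  then obtain x where "pts l \<inter> pts m = {x}" using linear_family_meet[OF A, of l m] T by blast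
  moreover have "p \<in> pts l \<inter> pts m" using T lm by auto
  ultimately have "q \<notin> pts l \<inter> pts m" using pq(1) by simp
  hence "q \<notin> pts l \<or> q \<notin> pts m" by blast
  thus ?thesis using that T lm by auto
qed

text \<open>A line through p that avoids q meets a line through q that avoids p in a point other
  than p.\<close>

lemma two_crossings:
  assumes A: "linear_family pts A" and pq: "p \<noteq> q" "2 \<le> deg pts A p" "2 \<le> deg pts A q"
  obtains l where "l \<in> A" "2 \<le> card (crossings pts A l)"
proof -
  obtain l where l: "l \<in> A" "p \<in> pts l" "q \<notin> pts l"
    using line_through_avoiding[OF A pq(1,2)] .
  obtain m where m: "m \<in> A" "q \<in> pts m" "p \<notin> pts m"
    using line_through_avoiding[OF A pq(1)[symmetric] pq(3)] .
  obtain x where x: "pts l \<inter> pts m = {x}"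
    using linear_family_meet[OF A, of l m] l m by metis
  have finA: "finite A" using A by (simp add: linear_family_def)
  have "card ({k \<in> A. p \<in> pts k} - {l}) \<ge> 1"
    using pq(2) finA l by (simp add: deg_def)
  then obtain k where "k \<in> A" "p \<in> pts k" "k \<noteq> l"
    by (metis (no_types, lifting) Diff_iff card.empty equals0I mem_Collect_eq not_one_le_zero singletonI)
  hence "{p, x} \<subseteq> crossings pts A l"
    using l m x by (auto simp: crossings_def)
  hence "card {p, x} \<le> card (crossings pts A l)"
    by (intro card_mono card_crossings_le_others(1)[OF A l(1)])
  moreover have "p \<noteq> x" using x m by auto
  ultimately show ?thesis using that[OF l(1)] by simp
qed

section \<open>Homogeneous forms as functions\<close>

text \<open>Forms are treated as functions generated by the coordinates, so that restriction to a line and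
  division by a linear form become rule inductions instead of computations in the polynomial
  ring.\<close>

inductive hform :: "nat \<Rightarrow> (complex ^ 3 \<Rightarrow> complex) \<Rightarrow> bool" where
  hform_const: "hform 0 (\<lambda>v. c)"
| hform_times: "hform n g \<Longrightarrow> hform (Suc n) (\<lambda>v. v $ i * g v)"
| hform_add: "hform n g \<Longrightarrow> hform n h \<Longrightarrow> hform n (\<lambda>v. g v + h v)"

lemma hform_cong: "hform n g \<Longrightarrow> (\<And>v. g v = h v) \<Longrightarrow> hform n h"
  using ext[of g h] by metis

lemma hform_cmult: "hform n g \<Longrightarrow> hform n (\<lambda>v. c * g v)"
proof (induction rule: hform.induct)
  case (hform_const c')
  show ?case by (rule hform.hform_const)
next
  case (hform_times n g i)
  show ?case by (rule hform_cong[OF hform.hform_times[OF hform_times.IH, of i]]) (simp add: mult_ac)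
next
  case (hform_add n g h)
  show ?case
    by (rule hform_cong[OF hform.hform_add[OF hform_add.IH]]) (simp add: algebra_simps)
qed

lemma hform_zero: "hform n (\<lambda>v. 0)"
proof (induction n)
  case 0
  show ?case by (rule hform_const)
next
  case (Suc n)
  show ?case by (rule hform_cong[OF hform_times[OF Suc]]) simp
qed

lemma hform_diff: "hform n g \<Longrightarrow> hform n h \<Longrightarrow> hform n (\<lambda>v. g v - h v)"
  by (rule hform_cong[OF hform_add[OF _ hform_cmult[of n h "-1"]]]) auto

lemma hform_sum: "(\<And>x. x \<in> X \<Longrightarrow> hform n (F x)) \<Longrightarrow> hform n (\<lambda>v. \<Sum>x\<in>X. F x v)"
  by (induction X rule: infinite_finite_induct) (simp_all add: hform_zero hform_add)

lemma hform_mult: "hform m g \<Longrightarrow> hform n h \<Longrightarrow> hform (m + n) (\<lambda>v. g v * h v)"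
proof (induction rule: hform.induct)
  case (hform_const c)
  thus ?case by (simp add: hform_cmult)
next
  case (hform_times m g i)
  show ?case
    using hform_cong[OF hform.hform_times[OF hform_times.IH[OF hform_times.prems], of i]]
    by (simp add: mult_ac)
next
  case (hform_add m g g')
  show ?case
    by (rule hform_cong[OF hform.hform_add[OF hform_add.IH[OF hform_add.prems]]])
       (simp add: algebra_simps)
qed

lemma hform_coord: "hform 1 (\<lambda>v. v $ i)"
  using hform_times[OF hform_const[of 1], of i] by simp

lemma hform_dot: "hform 1 (\<lambda>v. dot n v)"
  unfolding dot_def by (intro hform_sum hform_cmult hform_coord)

lemma hform_coord_times: "hform n g \<Longrightarrow> hform (n + 1) (\<lambda>v. v $ i * g v)"
  using hform_times by simp

lemma hform_power_coord: "hform k (\<lambda>v. (v $ i) ^ k)"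
  by (induction k) (simp_all add: hform_const hform_times)

lemma hform_prod:
  assumes "finite X" "\<And>x. x \<in> X \<Longrightarrow> hform (k x) (F x)"
  shows "hform (\<Sum>x\<in>X. k x) (\<lambda>v. \<Prod>x\<in>X. F x v)"
  using assms by (induction X rule: finite_induct) (simp_all add: hform_const hform_mult)

lemma hform_eval:
  assumes "homogeneous q f"
  shows "hform q (eval f)"
proof -
  have "hform q (\<lambda>v. Poly_Mapping.lookup f m * (\<Prod>i\<in>UNIV. (v $ i) ^ Poly_Mapping.lookup m i))"
    if "m \<in> Poly_Mapping.keys f" for m
  proof -
    have "hform (\<Sum>i\<in>UNIV. Poly_Mapping.lookup m i)
            (\<lambda>v. \<Prod>i\<in>UNIV. (v $ i) ^ Poly_Mapping.lookup m i)"
      by (rule hform_prod) (simp_all add: hform_power_coord)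
    thus ?thesis using assms that by (simp add: homogeneous_def hform_cmult)
  qed
  hence "hform q (\<lambda>v. \<Sum>m\<in>Poly_Mapping.keys f.
            Poly_Mapping.lookup f m * (\<Prod>i\<in>UNIV. (v $ i) ^ Poly_Mapping.lookup m i))"
    by (rule hform_sum)
  thus ?thesis by (rule hform_cong) (simp add: eval_def subst_def)
qed

lemma hform_0_const: "hform 0 g \<Longrightarrow> g v = g w"
proof -
  have "hform n g \<Longrightarrow> n = 0 \<Longrightarrow> g v = g w" for n
    by (induction rule: hform.induct) auto
  thus "hform 0 g \<Longrightarrow> g v = g w" by simp
qed

lemma hform_scale: "hform n g \<Longrightarrow> g (c *s v) = c ^ n * g v"
  by (induction rule: hform.induct) (simp_all add: algebra_simps)

text \<open>The coefficient of \<open>t ^ n\<close> is the value at w, the point at infinity of the affine line; it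
  shows that the polynomial is nonzero.\<close>

lemma hform_on_line:
  assumes "hform n g"
  obtains p where "degree p \<le> n" "coeff p n = g w" "\<And>t. poly p t = g (v + t *s w)"
proof -
  have "\<exists>p. degree p \<le> n \<and> coeff p n = g w \<and> (\<forall>t. poly p t = g (v + t *s w))"
    using assms
  proof (induction rule: hform.induct)
    case (hform_const c)
    show ?case by (rule exI[of _ "[:c:]"]) simp
  next
    case (hform_times n g i)
    then obtain p where p: "degree p \<le> n" "coeff p n = g w" "\<forall>t. poly p t = g (v + t *s w)"
      by blast
    have "degree ([:v $ i, w $ i:] * p) \<le> degree [:v $ i, w $ i:] + degree p"
      by (rule degree_mult_le)
    also have "\<dots> \<le> Suc n" using p(1) by simp
    finally have "degree ([:v $ i, w $ i:] * p) \<le> Suc n" .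
    moreover have "coeff p (Suc n) = 0" using p(1) by (simp add: coeff_eq_0)
    hence "coeff ([:v $ i, w $ i:] * p) (Suc n) = w $ i * g w"
      using p(2) by (simp add: mult_pCons_left)
    moreover have "\<forall>t. poly ([:v $ i, w $ i:] * p) t = (v + t *s w) $ i * g (v + t *s w)"
      using p(3) by (simp add: algebra_simps)
    ultimately show ?case by blast
  next
    case (hform_add n g h)
    then obtain p q where
      "degree p \<le> n" "coeff p n = g w" "\<forall>t. poly p t = g (v + t *s w)"
      "degree q \<le> n" "coeff q n = h w" "\<forall>t. poly q t = h (v + t *s w)" by blast
    thus ?case by (intro exI[of _ "p + q"]) (auto intro: degree_add_le)
  qed
  thus ?thesis using that by blast
qed

text \<open>Restrict both forms to the affine line from v in the direction w: there the second is a
  nonzero polynomial in t, and complex polynomials have no zero divisors.\<close>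

lemma hform_mult_eq_0_on:
  assumes g: "hform m g" and h: "hform n h"
    and W: "\<And>v w t. v \<in> W \<Longrightarrow> w \<in> W \<Longrightarrow> v + t *s w \<in> W"
    and gh: "\<And>v. v \<in> W \<Longrightarrow> g v * h v = 0"
    and w: "w \<in> W" "h w \<noteq> 0" and v: "v \<in> W"
  shows "g v = 0"
proof -
  obtain p where p: "\<And>t. poly p t = g (v + t *s w)" using hform_on_line[OF g] by metis
  obtain q where q: "coeff q n = h w" "\<And>t. poly q t = h (v + t *s w)"
    using hform_on_line[OF h] by metis
  have "\<forall>t. poly (p * q) t = 0"
    using gh[OF W[OF v w(1)]] by (simp add: p q)
  hence "p * q = 0" by (simp only: poly_all_0_iff_0)
  moreover have "q \<noteq> 0" using q w by auto
  ultimately have "p = 0" by simp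
  thus ?thesis using p[of 0] by simp
qed

lemma hform_prod_nonzero_on:
  assumes X: "finite X" "\<And>x. x \<in> X \<Longrightarrow> hform (k x) (F x)" "\<And>x. x \<in> X \<Longrightarrow> \<exists>w\<in>W. F x w \<noteq> 0"
    and W: "\<And>v w t. v \<in> W \<Longrightarrow> w \<in> W \<Longrightarrow> v + t *s w \<in> W" "W \<noteq> {}"
  shows "\<exists>w\<in>W. (\<Prod>x\<in>X. F x w) \<noteq> 0"
  using X
proof (induction X rule: finite_induct)
  case empty
  show ?case using W(2) by auto
next
  case (insert x X)
  then obtain w where w: "w \<in> W" "(\<Prod>x\<in>X. F x w) \<noteq> 0" by blast
  obtain v where v: "v \<in> W" "F x v \<noteq> 0" using insert.prems by blast
  show ?case
  proof (rule ccontr)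
    assume *: "\<not> ?thesis"
    have "F x v = 0"
      by (rule hform_mult_eq_0_on[where h = "\<lambda>v. \<Prod>x\<in>X. F x v", OF _ hform_prod W(1)])
         (use * insert w v in auto)
    thus False using v by simp
  qed
qed

text \<open>Since \<open>dot m w = 1\<close>, the map \<open>v \<mapsto> v - dot m v w\<close> is the projection onto the plane
  \<open>dot m v = 0\<close> along w, and a form differs from its composite with this projection by a
  multiple of \<open>dot m\<close>.  If the form vanishes on the plane, then the composite is zero, which
  gives the divisibility in \<open>hform_divide\<close>.\<close>

lemma hform_diff_projection:
  assumes "hform n g" "dot m w = 1"
  shows "n = 0 \<and> (\<forall>v. g v - g (v - dot m v *s w) = 0) \<or>
         (\<exists>k g'. n = Suc k \<and> hform k g' \<and> (\<forall>v. g v - g (v - dot m v *s w) = dot m v * g' v))"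
    and "hform n (\<lambda>v. g (v - dot m v *s w))"
proof -
  let ?\<pi> = "\<lambda>v. v - dot m v *s w"
  have "(n = 0 \<and> (\<forall>v. g v - g (?\<pi> v) = 0) \<or>
         (\<exists>k g'. n = Suc k \<and> hform k g' \<and> (\<forall>v. g v - g (?\<pi> v) = dot m v * g' v)))
       \<and> hform n (\<lambda>v. g (?\<pi> v))"
    using assms(1)
  proof (induction rule: hform.induct)
    case (hform_const c)
    show ?case by (auto intro: hform.hform_const)
  next
    case (hform_times n g i)
    have \<pi>: "hform n (\<lambda>v. g (?\<pi> v))" using hform_times by blast
    have "hform (1 + n) (\<lambda>v. (v $ i - w $ i * dot m v) * g (?\<pi> v))"
      by (intro hform_mult hform_diff hform_cmult hform_coord hform_dot \<pi>)
    hence 1: "hform (Suc n) (\<lambda>v. ?\<pi> v $ i * g (?\<pi> v))" by (simp add: mult.commute)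
    have "\<exists>g'. hform n g' \<and> (\<forall>v. v $ i * g v - ?\<pi> v $ i * g (?\<pi> v) = dot m v * g' v)"
      using hform_times.IH
    proof (elim conjE disjE exE)
      assume "\<forall>v. g v - g (?\<pi> v) = 0"
      hence "\<forall>v. v $ i * g v - ?\<pi> v $ i * g (?\<pi> v) = dot m v * (w $ i * g (?\<pi> v))"
        by (simp add: algebra_simps)
      thus ?thesis using hform_cmult[OF \<pi>] by blast
    next
      fix k g' assume *: "n = Suc k" "hform k g'" "\<forall>v. g v - g (?\<pi> v) = dot m v * g' v"
      have "hform n (\<lambda>v. v $ i * g' v + w $ i * g (?\<pi> v))"
        using hform_add[OF hform.hform_times[OF *(2), of i]] hform_cmult[OF \<pi>] *(1) by blast
      moreover have "v $ i * g v - ?\<pi> v $ i * g (?\<pi> v) =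
          dot m v * (v $ i * g' v + w $ i * g (?\<pi> v))" for v
      proof -
        have "g v = g (?\<pi> v) + dot m v * g' v" using *(3) by (metis add.commute diff_add_cancel)
        thus ?thesis by (simp add: algebra_simps)
      qed
      ultimately show ?thesis by blast
    qed
    thus ?case using 1 by blast
  next
    case (hform_add n g h)
    have "hform n (\<lambda>v. g (?\<pi> v))" "hform n (\<lambda>v. h (?\<pi> v))"
      using hform_add.IH by blast+
    from hform.hform_add[OF this]
    have 1: "hform n (\<lambda>v. g (?\<pi> v) + h (?\<pi> v))" .
    show ?case
    proof (cases n)
      case 0
      thus ?thesis using hform_add.IH 1 by auto
    next
      case (Suc k)
      then obtain g' h' where *: "hform k g'" "hform k h'"
        "\<forall>v. g v - g (?\<pi> v) = dot m v * g' v" "\<forall>v. h v - h (?\<pi> v) = dot m v * h' v"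
        using hform_add.IH by auto
      have "g v + h v - (g (?\<pi> v) + h (?\<pi> v)) = dot m v * (g' v + h' v)" for v
      proof -
        have "g v + h v - (g (?\<pi> v) + h (?\<pi> v)) = (g v - g (?\<pi> v)) + (h v - h (?\<pi> v))"
          by simp
        thus ?thesis using *(3,4) by (simp only: distrib_left)
      qed
      thus ?thesis using 1 Suc hform.hform_add[OF *(1,2)] by blast
    qed
  qed
  thus "n = 0 \<and> (\<forall>v. g v - g (?\<pi> v) = 0) \<or>
         (\<exists>k g'. n = Suc k \<and> hform k g' \<and> (\<forall>v. g v - g (?\<pi> v) = dot m v * g' v))"
    and "hform n (\<lambda>v. g (?\<pi> v))"
    by blast+
qed

lemma dot_add: "dot n (v + w) = dot n v + dot n w"
  by (simp add: dot_def algebra_simps sum.distrib)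

lemma dot_scale: "dot n (c *s v) = c * dot n v"
  by (simp add: dot_def sum_distrib_left mult_ac)

lemma dot_diff: "dot n (v - w) = dot n v - dot n w"
  by (simp add: dot_def algebra_simps sum_subtractf)

lemma dot_zero [simp]: "dot n 0 = 0"
  by (simp add: dot_def)

lemma dot_axis: "dot n (axis i 1) = n $ i"
  by (simp add: dot_def axis_def if_distrib cong: if_cong)

lemma dot_eq_1_exists:
  assumes "n \<noteq> 0"
  obtains w where "dot n w = 1"
proof -
  obtain i where "n $ i \<noteq> 0" using assms by (auto simp: vec_eq_iff)
  hence "dot n (inverse (n $ i) *s axis i 1) = 1" by (simp add: dot_scale dot_axis)
  thus ?thesis by (rule that)
qed

lemma hform_divide:
  assumes g: "hform (Suc k) g" and m: "m \<noteq> 0" and van: "\<And>v. dot m v = 0 \<Longrightarrow> g v = 0"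
  obtains g' where "hform k g'" "\<And>v. g v = dot m v * g' v"
proof -
  obtain w where w: "dot m w = 1" using dot_eq_1_exists[OF m] .
  have "g (v - dot m v *s w) = 0" for v
    by (rule van) (simp add: dot_diff dot_scale w)
  thus ?thesis using hform_diff_projection(1)[OF g w] that by auto
qed

section \<open>Forms tangent to an arrangement\<close>

definition cross :: "complex ^ 3 \<Rightarrow> complex ^ 3 \<Rightarrow> complex ^ 3" where
  "cross v w = (\<chi> i. v $ (i + 1) * w $ (i + 2) - v $ (i + 2) * w $ (i + 1))"

lemma index_3_numerals [simp]: "(4::3) = 1" "(5::3) = 2"
  by simp_all

lemma cross_simps:
  "cross v w $ 1 = v $ 2 * w $ 3 - v $ 3 * w $ 2"
  "cross v w $ 2 = v $ 3 * w $ 1 - v $ 1 * w $ 3"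
  "cross v w $ 3 = v $ 1 * w $ 2 - v $ 2 * w $ 1"
  by (simp_all add: cross_def)

lemma dot_simps: "dot n v = n $ 1 * v $ 1 + n $ 2 * v $ 2 + n $ 3 * v $ 3"
  by (simp add: dot_def sum_3)

lemma dot_cross [simp]: "dot v (cross v w) = 0" "dot w (cross v w) = 0"
  by (simp_all add: dot_simps cross_simps algebra_simps)

lemma cross_eq_0_iff: "cross v w = 0 \<longleftrightarrow> (\<forall>i j. v $ i * w $ j = v $ j * w $ i)"
proof (intro iffI allI)
  fix i j assume "cross v w = 0"
  hence "cross v w $ 1 = 0" "cross v w $ 2 = 0" "cross v w $ 3 = 0" by simp_all
  hence e: "v $ 2 * w $ 3 = v $ 3 * w $ 2" "v $ 3 * w $ 1 = v $ 1 * w $ 3"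
    "v $ 1 * w $ 2 = v $ 2 * w $ 1"
    unfolding cross_simps right_minus_eq .
  show "v $ i * w $ j = v $ j * w $ i"
    using exhaust_3[of i] exhaust_3[of j] by (elim disjE) (simp_all only: e)
next
  assume "\<forall>i j. v $ i * w $ j = v $ j * w $ i"
  thus "cross v w = 0" unfolding cross_def vec_eq_iff by simp
qed

lemma cross_eq_0_imp_scaled:
  assumes "cross v w = 0" "v \<noteq> 0"
  obtains c where "w = c *s v"
proof -
  obtain i where i: "v $ i \<noteq> 0" using assms(2) by (auto simp: vec_eq_iff)
  have "w $ j = (w $ i / v $ i) * v $ j" for j
    using assms(1) i by (simp add: cross_eq_0_iff field_simps)
  hence "w = (w $ i / v $ i) *s v" unfolding vec_eq_iff vector_smult_component by blast
  thus ?thesis by (rule that)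
qed

lemma cross_scaled [simp]: "cross (a *s v) (b *s v) = 0" "cross v (b *s v) = 0" "cross (a *s v) v = 0"
  by (simp_all add: vec_eq_iff forall_3 cross_simps)

lemma cross_cross: "cross v (cross n m) = dot m v *s n - dot n v *s m"
  by (simp add: vec_eq_iff forall_3 cross_simps dot_simps algebra_simps)

lemma orthogonal_both_imp_scaled:
  assumes "cross n m \<noteq> 0" "dot n v = 0" "dot m v = 0"
  obtains c where "v = c *s cross n m"
proof -
  have "cross v (cross n m) = 0" using assms by (simp add: cross_cross)
  hence "cross (cross n m) v = 0" by (simp add: cross_eq_0_iff mult.commute)
  thus ?thesis using cross_eq_0_imp_scaled assms(1) that by metis
qed

lemma parallel_both_imp_zero:
  assumes "cross n m \<noteq> 0" "cross w n = 0" "cross w m = 0"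
  shows "w = 0"
proof (rule ccontr)
  assume w: "w \<noteq> 0"
  obtain a b where "n = a *s w" "m = b *s w"
    using cross_eq_0_imp_scaled[OF assms(2) w] cross_eq_0_imp_scaled[OF assms(3) w] by metis
  thus False using assms(1) by simp
qed

text \<open>Cramer's rule for v in the basis \<open>u, w, e\<^sub>i\<close>; the coefficient of \<open>e\<^sub>i\<close> is the
  determinant \<open>dot (cross u w) v\<close> divided by \<open>cross u w $ i\<close>.\<close>

lemma plane_coordinates:
  assumes "cross u w $ i \<noteq> 0" "dot (cross u w) v = 0"
  shows "v = (cross v w $ i / cross u w $ i) *s u + (cross u v $ i / cross u w $ i) *s w"
proof -
  have *: "cross u w $ i * v $ j = cross v w $ i * u $ j + cross u v $ i * w $ j" for j
  proof -
    have "cross u w $ i * v $ j =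
        cross v w $ i * u $ j + cross u v $ i * w $ j + (if j = i then dot (cross u w) v else 0)"
      using exhaust_3[of i] exhaust_3[of j]
      by (elim disjE) (simp_all add: cross_simps dot_simps algebra_simps)
    thus ?thesis using assms(2) by simp
  qed
  show ?thesis using assms(1) *
    by (simp add: vec_eq_iff field_simps)
qed

definition line_pts :: "complex ^ 3 \<Rightarrow> (complex ^ 3) set set" where
  "line_pts n = {p \<in> P2. \<forall>v\<in>p. dot n v = 0}"

lemma P2_cases:
  assumes "p \<in> P2"
  obtains v where "v \<noteq> 0" "p = vec.span {v}"
  using assms by (auto simp: P2_def)

lemma span_in_line_pts: "v \<noteq> 0 \<Longrightarrow> vec.span {v} \<in> line_pts n \<longleftrightarrow> dot n v = 0"
  by (auto simp: line_pts_def P2_def vec.span_singleton dot_scale)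

lemma span_scaled: "c \<noteq> 0 \<Longrightarrow> vec.span {c *s v} = vec.span {v}"
  for v :: "complex ^ 3"
proof -
  assume c: "c \<noteq> 0"
  have "range (\<lambda>k. k *s (c *s v)) = range (\<lambda>k. k *s v)"
  proof (intro subset_antisym subsetI)
    fix x assume "x \<in> range (\<lambda>k. k *s v)"
    then obtain k where "x = k *s v" by blast
    hence "x = (k / c) *s (c *s v)" using c by simp
    thus "x \<in> range (\<lambda>k. k *s (c *s v))" by blast
  qed auto
  thus ?thesis by (simp add: vec.span_singleton)
qed

definition normals :: "(complex ^ 3) set \<Rightarrow> bool" where
  "normals N \<longleftrightarrow> finite N \<and> 0 \<notin> N \<and> (\<forall>n\<in>N. \<forall>m\<in>N. n \<noteq> m \<longrightarrow> cross n m \<noteq> 0)"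

lemma normals_subset: "normals N \<Longrightarrow> M \<subseteq> N \<Longrightarrow> normals M"
  unfolding normals_def by (meson finite_subset subsetD)

lemma linear_family_normals:
  assumes "normals N"
  shows "linear_family line_pts N"
  unfolding linear_family_def
proof (intro conjI ballI impI)
  show "finite N" using assms by (simp add: normals_def)
  fix n m assume nm: "n \<in> N" "m \<in> N" "n \<noteq> m"
  hence c: "cross n m \<noteq> 0" using assms by (simp add: normals_def)
  have "line_pts n \<inter> line_pts m = {vec.span {cross n m}}"
  proof (intro subset_antisym subsetI)
    fix p assume p: "p \<in> line_pts n \<inter> line_pts m"
    then obtain v where v: "v \<noteq> 0" "p = vec.span {v}"
      using P2_cases[of p] by (auto simp: line_pts_def)
    hence "dot n v = 0" "dot m v = 0" using p span_in_line_pts by auto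
    then obtain k where k: "v = k *s cross n m" using orthogonal_both_imp_scaled[OF c] by blast
    hence "k \<noteq> 0" using v(1) by auto
    thus "p \<in> {vec.span {cross n m}}" using v k by (simp add: span_scaled)
  next
    fix p assume "p \<in> {vec.span {cross n m}}"
    thus "p \<in> line_pts n \<inter> line_pts m" using span_in_line_pts[OF c] by simp
  qed
  thus "\<exists>p. line_pts n \<inter> line_pts m = {p}" by blast
qed

text \<open>The line with normal vector n is an integral curve of the foliation defined by \<open>\<omega>\<close>.\<close>

definition tangent :: "(complex ^ 3 \<Rightarrow> complex ^ 3) \<Rightarrow> complex ^ 3 \<Rightarrow> bool" where
  "tangent \<omega> n \<longleftrightarrow> (\<forall>v. dot n v = 0 \<longrightarrow> cross (\<omega> v) n = 0)"

definition vector_form :: "nat \<Rightarrow> (complex ^ 3 \<Rightarrow> complex ^ 3) \<Rightarrow> bool" where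
  "vector_form s \<omega> \<longleftrightarrow> (\<forall>i. hform s (\<lambda>v. \<omega> v $ i))"

lemma vector_form_scale:
  assumes "vector_form s \<omega>"
  shows "\<omega> (c *s v) = c ^ s *s \<omega> v"
proof -
  have "\<omega> (c *s v) $ i = c ^ s * \<omega> v $ i" for i
    using assms hform_scale[of s "\<lambda>v. \<omega> v $ i"] by (simp add: vector_form_def)
  thus ?thesis by (simp add: vec_eq_iff)
qed

text \<open>At a crossing, \<open>\<omega>\<close> is parallel to two independent normal vectors, hence zero.  With a
  crossing u as origin and w as point at infinity, the other points of the line are
  \<open>u + t w\<close>, and a component of \<open>\<omega>\<close> becomes a polynomial in t of degree at most s that
  vanishes at every crossing.  Its coefficient of \<open>t ^ s\<close> is the component of \<open>\<omega> w\<close>, which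
  is nonzero for a suitable component.\<close>

lemma crossings_le_degree:
  assumes \<omega>: "vector_form s \<omega>" and N: "normals N" and tan: "\<And>m. m \<in> N \<Longrightarrow> tangent \<omega> m"
    and n: "n \<in> N" and w: "dot n w = 0" "\<omega> w \<noteq> 0"
  shows "card (crossings line_pts N n) \<le> s"
proof (cases "crossings line_pts N n = {}")
  case False
  have crossing: "\<exists>u. u \<noteq> 0 \<and> p = vec.span {u} \<and> dot n u = 0 \<and> \<omega> u = 0"
    if p: "p \<in> crossings line_pts N n" for p
  proof -
    obtain m where m: "m \<in> N" "m \<noteq> n" "p \<in> line_pts n" "p \<in> line_pts m"
      using p by (auto simp: crossings_def)
    then obtain u where u: "u \<noteq> 0" "p = vec.span {u}"
      using P2_cases[of p] by (auto simp: line_pts_def)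
    hence "dot n u = 0" "dot m u = 0" using m span_in_line_pts by auto
    moreover from this have "cross (\<omega> u) n = 0" "cross (\<omega> u) m = 0"
      using tan n m(1) by (auto simp: tangent_def)
    moreover have "cross n m \<noteq> 0" using N n m by (simp add: normals_def)
    ultimately show ?thesis using u parallel_both_imp_zero by blast
  qed
  then obtain u where u: "u \<noteq> 0" "dot n u = 0" "\<omega> u = 0" using False by blast
  have c: "cross u w \<noteq> 0"
  proof
    assume "cross u w = 0"
    then obtain k where "w = k *s u" using cross_eq_0_imp_scaled u(1) by blast
    thus False using w(2) u(3) vector_form_scale[OF \<omega>] by simp
  qed
  have "n \<noteq> 0" using N n by (auto simp: normals_def)
  obtain k where k: "n = k *s cross u w"
    using orthogonal_both_imp_scaled[OF c, of n] u(2) w(1) by (auto simp: dot_def mult.commute)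
  hence "k \<noteq> 0" using \<open>n \<noteq> 0\<close> by auto
  obtain i where i: "cross u w $ i \<noteq> 0" using c by (auto simp: vec_eq_iff)
  obtain j where j: "\<omega> w $ j \<noteq> 0" using w(2) by (auto simp: vec_eq_iff)
  have "hform s (\<lambda>v. \<omega> v $ j)" using \<omega> by (simp add: vector_form_def)
  then obtain p where p: "degree p \<le> s" "coeff p s = \<omega> w $ j" "\<And>t. poly p t = \<omega> (u + t *s w) $ j"
    by (rule hform_on_line[where v = u and w = w]) blast
  have p0: "p \<noteq> 0" using p(2) j by auto
  have "crossings line_pts N n \<subseteq> (\<lambda>t. vec.span {u + t *s w}) ` {t. poly p t = 0}"
  proof
    fix q assume "q \<in> crossings line_pts N n"
    then obtain v where v: "v \<noteq> 0" "q = vec.span {v}" "dot n v = 0" "\<omega> v = 0"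
      using crossing by blast
    have "dot (cross u w) v = 0"
      using v(3) k \<open>k \<noteq> 0\<close> by (simp add: dot_def mult.assoc flip: sum_distrib_left)
    then obtain a b where ab: "v = a *s u + b *s w" using plane_coordinates[OF i] by blast
    \<comment> \<open>The point w at infinity is not a crossing.\<close>
    have "a \<noteq> 0"
    proof
      assume "a = 0"
      hence vb: "v = b *s w" using ab by simp
      hence "b \<noteq> 0" using v(1) by auto
      thus False using vb v(4) w(2) vector_form_scale[OF \<omega>, of b w] by simp
    qed
    hence eq: "v = a *s (u + (b / a) *s w)" using ab by (simp add: vector_add_ldistrib)
    hence "\<omega> (u + (b / a) *s w) = 0"
      using v(4) vector_form_scale[OF \<omega>, of a "u + (b / a) *s w"] \<open>a \<noteq> 0\<close> by simp
    hence "poly p (b / a) = 0" using p(3) by simp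
    moreover have "q = vec.span {u + (b / a) *s w}" using v(2) eq span_scaled \<open>a \<noteq> 0\<close> by metis
    ultimately show "q \<in> (\<lambda>t. vec.span {u + t *s w}) ` {t. poly p t = 0}" by blast
  qed
  hence "card (crossings line_pts N n) \<le> card {t. poly p t = 0}"
    using poly_roots_finite[OF p0] by (meson card_image_le card_mono finite_imageI order_trans)
  also have "\<dots> \<le> degree p" by (rule card_poly_roots_bound[OF p0])
  finally show ?thesis using p(1) by simp
qed simp

lemma exists_on_plane_off_plane:
  assumes "cross n m \<noteq> 0"
  obtains v where "dot n v = 0" "dot m v \<noteq> 0"
proof -
  obtain i where i: "cross n m $ i \<noteq> 0" using assms by (auto simp: vec_eq_iff)
  let ?v = "cross n (axis i 1)"
  have "dot m ?v = - cross n m $ i"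
    using exhaust_3[of i] by (elim disjE) (simp_all add: dot_simps cross_simps axis_def)
  thus ?thesis using that[of ?v] i by simp
qed

text \<open>Tangency of the quotient is clear where \<open>dot n\<close> is nonzero.  As the two lines differ, this
  is a dense part of the plane over m.\<close>

lemma tangent_divide:
  assumes \<omega>': "vector_form k \<omega>'" and \<omega>: "\<And>v. \<omega> v = dot n v *s \<omega>' v" "tangent \<omega> m"
    and c: "cross m n \<noteq> 0"
  shows "tangent \<omega>' m"
  unfolding tangent_def
proof (intro allI impI)
  fix v assume v: "dot m v = 0"
  obtain w where w: "dot m w = 0" "dot n w \<noteq> 0" using exists_on_plane_off_plane[OF c] .
  have "cross (\<omega>' v) m $ i = 0" for i
  proof -
    have h: "hform k (\<lambda>v. \<omega>' v $ j)" for j using \<omega>' by (simp add: vector_form_def)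
    have "hform k (\<lambda>v. m $ (i + 2) * \<omega>' v $ (i + 1) - m $ (i + 1) * \<omega>' v $ (i + 2))"
      by (intro hform_diff hform_cmult h)
    hence 1: "hform k (\<lambda>v. cross (\<omega>' v) m $ i)"
      by (rule hform_cong) (simp add: cross_def)
    show ?thesis
    proof (rule hform_mult_eq_0_on[OF 1 hform_dot, of "{v. dot m v = 0}" n])
      fix x assume "x \<in> {v. dot m v = 0}"
      hence "cross (dot n x *s \<omega>' x) m $ i = 0"
        using \<omega> by (simp add: tangent_def)
      thus "cross (\<omega>' x) m $ i * dot n x = 0"
        by (simp add: cross_def algebra_simps)
    qed (use v w in \<open>auto simp: dot_add dot_scale\<close>)
  qed
  thus "cross (\<omega>' v) m = 0" by (simp add: vec_eq_iff)
qed

lemma vector_form_divide: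
  assumes \<omega>: "vector_form (Suc k) \<omega>" and n: "n \<noteq> 0" and van: "\<And>v. dot n v = 0 \<Longrightarrow> \<omega> v = 0"
  obtains \<omega>' where "vector_form k \<omega>'" "\<And>v. \<omega> v = dot n v *s \<omega>' v"
proof -
  have "\<exists>g. hform k g \<and> (\<forall>v. \<omega> v $ i = dot n v * g v)" for i
  proof -
    have h: "hform (Suc k) (\<lambda>v. \<omega> v $ i)" using \<omega> by (simp add: vector_form_def)
    have z: "\<omega> v $ i = 0" if "dot n v = 0" for v using van[OF that] by simp
    show ?thesis by (rule hform_divide[OF h n z]) blast+
  qed
  then obtain g where g: "\<And>i. hform k (g i)" "\<And>i v. \<omega> v $ i = dot n v * g i v" by metis
  show ?thesis
    by (rule that[of "\<lambda>v. \<chi> i. g i v"]) (simp_all add: vector_form_def g vec_eq_iff)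
qed

text \<open>Induction on the degree.  If \<open>\<omega>\<close> vanishes on a line, pass to the quotient by its linear form
  and to the remaining lines: with \<open>s = k + 1\<close> and \<open>card N = d + 1\<close>, the bounds on the excess
  for \<open>(s, N)\<close> and for \<open>(k, N - {n})\<close> differ by d, the largest possible number of crossings on
  the removed line.  Otherwise the number of crossings on each line is at most s.  The saving
  needs two points of multiplicity three, because the lines left at the end may form a pencil,
  and its centre saves nothing.\<close>

lemma excess_le_of_tangent_form:
  assumes "vector_form s \<omega>" "normals N" "\<And>m. m \<in> N \<Longrightarrow> tangent \<omega> m" "\<omega> x \<noteq> 0" "s \<le> card N"
  shows "2 * excess line_pts N + s * (s + 1) \<le> 2 * card N * s \<and>
    (\<forall>p q. p \<noteq> q \<and> 3 \<le> deg line_pts N p \<and> 3 \<le> deg line_pts N q \<longrightarrow>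
       2 * excess line_pts N + s * (s + 1) + 2 \<le> 2 * card N * s)"
  using assms
proof (induction s arbitrary: \<omega> N x rule: less_induct)
  case (less s)
  have lin: "linear_family line_pts N" by (rule linear_family_normals[OF less.prems(2)])
  have finN: "finite N" using less.prems(2) by (simp add: normals_def)
  show ?case
  proof (cases "\<exists>n\<in>N. \<forall>v. dot n v = 0 \<longrightarrow> \<omega> v = 0")
    case False
    have s: "card (crossings line_pts N n) \<le> s" if "n \<in> N" for n
      using crossings_le_degree[OF less.prems(1-3) that] False that by blast
    have "2 * excess line_pts N + s * (s + 1) + 2 \<le> 2 * card N * s"
      if pq: "p \<noteq> q" "3 \<le> deg line_pts N p" "3 \<le> deg line_pts N q" for p q
    proof -
      obtain l where "l \<in> N" "2 \<le> card (crossings line_pts N l)"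
        using two_crossings[OF lin pq(1)] pq by auto
      hence "2 \<le> s" using s[of l] by simp
      thus ?thesis using excess_bound_triple[OF lin s less.prems(5) pq(2)] by blast
    qed
    thus ?thesis using excess_bound[OF lin s less.prems(5)] by blast
  next
    case True
    then obtain n where n: "n \<in> N" "\<And>v. dot n v = 0 \<Longrightarrow> \<omega> v = 0" by blast
    have n0: "n \<noteq> 0" using n(1) less.prems(2) by (auto simp: normals_def)
    have "s \<noteq> 0"
    proof
      assume "s = 0"
      hence "\<omega> x $ i = \<omega> 0 $ i" for i
        using hform_0_const less.prems(1) by (auto simp: vector_form_def)
      hence "\<omega> x = \<omega> 0" by (simp add: vec_eq_iff)
      thus False using n(2)[of 0] less.prems(4) by simp
    qed
    then obtain k where k: "s = Suc k" by (cases s) auto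
    obtain \<omega>' where \<omega>': "vector_form k \<omega>'" "\<And>v. \<omega> v = dot n v *s \<omega>' v"
      using vector_form_divide[OF less.prems(1)[unfolded k] n0 n(2)] by blast
    let ?M = "N - {n}"
    have tan: "tangent \<omega>' m" if "m \<in> ?M" for m
      by (rule tangent_divide[OF \<omega>'])
         (use that n(1) less.prems(2,3) in \<open>auto simp: normals_def\<close>)
    have M: "normals ?M" by (rule normals_subset[OF less.prems(2)]) auto
    have x: "\<omega>' x \<noteq> 0" using less.prems(4) \<omega>'(2)[of x] by auto
    obtain d where d: "card N = Suc d" using n(1) finN by (metis card_Suc_Diff1)
    hence cardM: "card ?M = d" using n(1) by simp
    have "k \<le> card ?M" using less.prems(5) k cardM d by simp
    note IH = less.IH[OF _ \<omega>'(1) M tan x this, unfolded k cardM, simplified]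
    have e: "excess line_pts N = excess line_pts ?M + card (crossings line_pts N n)"
      by (rule excess_remove[OF lin n(1)])
    have c: "card (crossings line_pts N n) \<le> d"
      using card_crossings_le_others(2)[OF lin n(1)] d by simp
    have "2 * excess line_pts N + s * (s + 1) + 2 \<le> 2 * card N * s"
      if pq: "p \<noteq> q" "3 \<le> deg line_pts N p" "3 \<le> deg line_pts N q" for p q
    proof (cases "p \<in> line_pts n \<or> q \<in> line_pts n")
      case True
      hence "card (crossings line_pts N n) + 2 \<le> card N"
        using card_crossings_le_triple[OF lin n(1)] pq by blast
      thus ?thesis using IH e unfolding k d by (simp add: algebra_simps)
    next
      case False
      have "deg line_pts N y = deg line_pts ?M y" if "y \<notin> line_pts n" for y
        using deg_insert[of ?M n line_pts y] finN n(1) that by (simp add: insert_absorb)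
      hence "3 \<le> deg line_pts ?M p" "3 \<le> deg line_pts ?M q" using pq False by auto
      hence "2 * excess line_pts ?M + k * (k + 1) + 2 \<le> 2 * d * k"
        using IH pq(1) by force
      thus ?thesis using c e unfolding k d by (simp add: algebra_simps)
    qed
    moreover have "2 * excess line_pts N + s * (s + 1) \<le> 2 * card N * s"
      using IH c e unfolding k d by (simp add: algebra_simps)
    ultimately show ?thesis by blast
  qed
qed

section \<open>The local ring of power series in two variables\<close>

definition coef :: "local_ring \<Rightarrow> nat \<Rightarrow> nat \<Rightarrow> complex" where
  "coef g i j = fps_nth (fps_nth g j) i"

lemma local_ring_eqI: "(\<And>i j. coef g i j = coef h i j) \<Longrightarrow> g = h"
  by (simp add: coef_def fps_eq_iff)

lemma coef_add [simp]: "coef (g + h) i j = coef g i j + coef h i j"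
  and coef_diff [simp]: "coef (g - h) i j = coef g i j - coef h i j"
  and coef_0 [simp]: "coef 0 i j = 0"
  by (simp_all add: coef_def)

lemma coef_sum [simp]: "coef (\<Sum>x\<in>X. F x) i j = (\<Sum>x\<in>X. coef (F x) i j)"
  by (simp add: coef_def fps_sum_nth)

lemma coef_1: "coef 1 i j = (if i = 0 \<and> j = 0 then 1 else 0)"
  by (simp add: coef_def fps_one_nth)

lemma coef_mult:
  "coef (g * h) i j = (\<Sum>b=0..j. \<Sum>a=0..i. coef g a b * coef h (i - a) (j - b))"
  by (simp add: coef_def fps_mult_nth fps_sum_nth)

lemma coef_mult_00: "coef (g * h) 0 0 = coef g 0 0 * coef h 0 0"
  by (simp add: coef_mult)

lemma coef_emb_mult [simp]: "coef (emb c * g) i j = c * coef g i j"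
  by (simp add: coef_def emb_def)

lemma coef_U_mult: "coef (U * g) i j = (if i = 0 then 0 else coef g (i - 1) j)"
  by (simp add: coef_def U_def)

lemma coef_V_mult: "coef (V * g) i j = (if j = 0 then 0 else coef g i (j - 1))"
  by (simp add: coef_def V_def)

lemma coef_emb: "coef (emb c) i j = (if i = 0 \<and> j = 0 then c else 0)"
  using coef_emb_mult[of c 1 i j] by (simp add: coef_1)

lemma coef_U: "coef U i j = (if i = 1 \<and> j = 0 then 1 else 0)"
  using coef_U_mult[of 1 i j] by (auto simp: coef_1)

lemma coef_V: "coef V i j = (if i = 0 \<and> j = 1 then 1 else 0)"
  using coef_V_mult[of 1 i j] by (auto simp: coef_1)

lemma ring_hom_emb:
  "emb 0 = 0" "emb 1 = 1" "emb (x + y) = emb x + emb y" "emb (x * y) = emb x * emb y"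
  by (simp_all add: emb_def)

lemma coef_deriv_U: "coef (deriv_U g) i j = of_nat (i + 1) * coef g (i + 1) j"
  by (simp add: coef_def deriv_U_def)

lemma coef_deriv_V: "coef (deriv_V g) i j = of_nat (j + 1) * coef g i (j + 1)"
proof -
  have "(of_nat m :: complex fps) = fps_const (of_nat m)" for m by (simp add: fps_of_nat)
  thus ?thesis by (simp add: coef_def deriv_V_def)
qed

lemma deriv_U_mult: "deriv_U (g * h) = deriv_U g * h + g * deriv_U h"
  by (rule fps_ext)
     (simp add: deriv_U_def fps_mult_nth fps_deriv_sum sum.distrib)

lemma deriv_V_mult: "deriv_V (g * h) = deriv_V g * h + g * deriv_V h"
  by (simp add: deriv_V_def)

text \<open>Membership in the k-th power of the maximal ideal.\<close>

definition vanishing :: "nat \<Rightarrow> local_ring \<Rightarrow> bool" where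
  "vanishing k g \<longleftrightarrow> (\<forall>i j. i + j < k \<longrightarrow> coef g i j = 0)"

lemma vanishing_mono: "vanishing k g \<Longrightarrow> l \<le> k \<Longrightarrow> vanishing l g"
  by (simp add: vanishing_def)

lemma vanishing_0 [simp]: "vanishing 0 g"
  by (simp add: vanishing_def)

lemma vanishing_add: "vanishing k g \<Longrightarrow> vanishing k h \<Longrightarrow> vanishing k (g + h)"
  by (simp add: vanishing_def)

lemma vanishing_mult:
  assumes "vanishing k g" "vanishing l h"
  shows "vanishing (k + l) (g * h)"
  unfolding vanishing_def
proof (intro allI impI)
  fix i j assume ij: "i + j < k + l"
  have "coef g a b * coef h (i - a) (j - b) = 0" if "a \<le> i" "b \<le> j" for a b
  proof (cases "a + b < k")
    case False
    hence "(i - a) + (j - b) < l" using ij that by linarith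
    thus ?thesis using assms(2) by (simp add: vanishing_def)
  qed (use assms(1) in \<open>simp add: vanishing_def\<close>)
  thus "coef (g * h) i j = 0" unfolding coef_mult by (intro sum.neutral ballI) auto
qed

lemma vanishing_mult_right: "vanishing k g \<Longrightarrow> vanishing k (h * g)"
  using vanishing_mult[of 0 h k g] by simp

lemma vanishing_deriv:
  assumes "vanishing (Suc k) g"
  shows "vanishing k (deriv_U g)" "vanishing k (deriv_V g)"
  using assms by (auto simp: vanishing_def coef_deriv_U coef_deriv_V simp del: of_nat_Suc)

lemma vanishing_Suc_split:
  assumes "vanishing (Suc k) g"
  obtains a b where "vanishing k a" "vanishing k b" "g = U * a + V * b"
proof -
  define a :: local_ring where "a = fps_const (fps_shift 1 (fps_nth g 0))"
  define b :: local_ring where "b = fps_shift 1 g"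
  have a: "coef a i j = (if j = 0 then coef g (i + 1) 0 else 0)" for i j
    by (simp add: a_def coef_def)
  have b: "coef b i j = coef g i (j + 1)" for i j
    by (simp add: b_def coef_def)
  have "g = U * a + V * b"
  proof (rule local_ring_eqI)
    fix i j
    have "coef g 0 0 = 0" using assms by (simp add: vanishing_def)
    thus "coef g i j = coef (U * a + V * b) i j"
      by (cases i; cases j) (simp_all add: coef_U_mult coef_V_mult a b)
  qed
  moreover have "vanishing k a" "vanishing k b"
    using assms by (simp_all add: vanishing_def a b)
  ultimately show ?thesis using that by blast
qed

lemma local_unit:
  assumes "coef g 0 0 \<noteq> 0"
  obtains h where "h * g = 1"
proof -
  let ?c = "fps_nth g 0"
  have "fps_nth ?c 0 \<noteq> 0" using assms by (simp add: coef_def)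
  hence "?c * inverse ?c = 1" by (rule inverse_mult_eq_1')
  hence "g * fps_right_inverse g (inverse ?c) = 1" by (rule fps_right_inverse)
  thus ?thesis using that by (metis mult.commute)
qed

definition local_ideal :: "local_ring set \<Rightarrow> bool" where
  "local_ideal I \<longleftrightarrow> 0 \<in> I \<and> (\<forall>x\<in>I. \<forall>y\<in>I. x + y \<in> I) \<and> (\<forall>x\<in>I. \<forall>a. a * x \<in> I)"

lemma local_ideal_add: "local_ideal I \<Longrightarrow> x \<in> I \<Longrightarrow> y \<in> I \<Longrightarrow> x + y \<in> I"
  and local_ideal_mult: "local_ideal I \<Longrightarrow> x \<in> I \<Longrightarrow> a * x \<in> I"
  by (simp_all add: local_ideal_def)

lemma local_ideal_unit:
  assumes "local_ideal I" "x \<in> I" "coef x 0 0 \<noteq> 0"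
  shows "y \<in> I"
proof -
  obtain h where "h * x = 1" using local_unit[OF assms(3)] .
  hence "(y * h) * x = y" by (simp add: mult.assoc)
  thus ?thesis using local_ideal_mult[OF assms(1,2), of "y * h"] by (simp only:)
qed

lemma local_ideal_tjurina: "local_ideal (tjurina_ideal g)"
  unfolding local_ideal_def
proof (intro conjI ballI allI)
  show "0 \<in> tjurina_ideal g"
    unfolding tjurina_ideal_def by (rule CollectI, rule exI[of _ 0], rule exI[of _ 0], rule exI[of _ 0]) simp
next
  fix x y assume "x \<in> tjurina_ideal g" "y \<in> tjurina_ideal g"
  then obtain a b c a' b' c' where "x = a * g + b * deriv_U g + c * deriv_V g"
    "y = a' * g + b' * deriv_U g + c' * deriv_V g" by (auto simp: tjurina_ideal_def)
  hence "x + y = (a + a') * g + (b + b') * deriv_U g + (c + c') * deriv_V g"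
    by (simp add: algebra_simps)
  thus "x + y \<in> tjurina_ideal g" unfolding tjurina_ideal_def by blast
next
  fix x d assume "x \<in> tjurina_ideal g"
  then obtain a b c where "x = a * g + b * deriv_U g + c * deriv_V g"
    by (auto simp: tjurina_ideal_def)
  hence "d * x = (d * a) * g + (d * b) * deriv_U g + (d * c) * deriv_V g"
    by (simp add: algebra_simps)
  thus "d * x \<in> tjurina_ideal g" unfolding tjurina_ideal_def by blast
qed

lemma tjurina_ideal_gens: "g \<in> tjurina_ideal g" "deriv_U g \<in> tjurina_ideal g" "deriv_V g \<in> tjurina_ideal g"
proof -
  have "g = 1 * g + 0 * deriv_U g + 0 * deriv_V g" "deriv_U g = 0 * g + 1 * deriv_U g + 0 * deriv_V g"
    "deriv_V g = 0 * g + 0 * deriv_U g + 1 * deriv_V g" by simp_all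
  thus "g \<in> tjurina_ideal g" "deriv_U g \<in> tjurina_ideal g" "deriv_V g \<in> tjurina_ideal g"
    unfolding tjurina_ideal_def by blast+
qed

section \<open>Finite dimension of Tjurina algebras of line arrangements\<close>

text \<open>Modulo \<open>l g\<close>, the product of \<open>l\<close> and \<open>\<partial>(l g) = \<partial>l g + l \<partial>g\<close> is \<open>l\<^sup>2 \<partial>g\<close>.\<close>

lemma tjurina_ideal_times_factor:
  assumes "x \<in> tjurina_ideal g"
  shows "l * l * x \<in> tjurina_ideal (l * g)"
proof -
  obtain a b c where x: "x = a * g + b * deriv_U g + c * deriv_V g"
    using assms by (auto simp: tjurina_ideal_def)
  have "l * l * x = (a * l - b * deriv_U l - c * deriv_V l) * (l * g)
      + (b * l) * deriv_U (l * g) + (c * l) * deriv_V (l * g)"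
    unfolding x deriv_U_mult deriv_V_mult by (simp add: algebra_simps)
  thus ?thesis unfolding tjurina_ideal_def by blast
qed

lemma vanishing_split_two_lines:
  assumes "a * b' - a' * b \<noteq> 0" and g: "vanishing (Suc k) g"
    and l: "l = emb a * U + emb b * V" "l' = emb a' * U + emb b' * V"
  obtains x y where "vanishing k x" "vanishing k y" "g = l * x + l' * y"
proof -
  obtain x y where xy: "vanishing k x" "vanishing k y" "g = U * x + V * y"
    using vanishing_Suc_split[OF g] .
  define \<delta> where "\<delta> = emb (inverse (a * b' - a' * b))"
  have \<delta>: "\<delta> * (emb a * emb b' - emb a' * emb b) = 1"
  proof -
    have "emb a * emb b' - emb a' * emb b = emb (a * b' - a' * b)"
      using ring_hom_emb(3)[of "a * b' - a' * b" "a' * b"] by (simp add: ring_hom_emb(4))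
    thus ?thesis using assms(1) by (simp add: \<delta>_def flip: ring_hom_emb(2,4))
  qed
  have "l * (\<delta> * (emb b' * x - emb a' * y)) + l' * (\<delta> * (emb a * y - emb b * x))
      = (\<delta> * (emb a * emb b' - emb a' * emb b)) * (U * x + V * y)"
    unfolding l by (simp add: algebra_simps)
  also have "\<dots> = g" unfolding \<delta> xy(3) by simp
  finally have "g = l * (\<delta> * (emb b' * x - emb a' * y)) + l' * (\<delta> * (emb a * y - emb b * x))" ..
  moreover have "vanishing k (c * (emb p * x - emb q * y))" "vanishing k (c * (emb p * y - emb q * x))"
    for c p q
    by (rule vanishing_mult_right, use xy(1,2) in \<open>simp add: vanishing_def\<close>)+
  ultimately show ?thesis using that by blast
qed

text \<open>Two independent linear forms generate the maximal ideal, and every product of three factors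
  from \<open>{l, l'}\<close> is divisible by \<open>l\<^sup>2\<close> or \<open>l'\<^sup>2\<close>.\<close>

lemma vanishing_subset_two_squares:
  assumes I: "local_ideal I" and ne: "a * b' - a' * b \<noteq> 0"
    and l: "l = emb a * U + emb b * V" "l' = emb a' * U + emb b' * V"
    and sq: "\<And>g. vanishing M g \<Longrightarrow> l * l * g \<in> I" "\<And>g. vanishing M g \<Longrightarrow> l' * l' * g \<in> I"
    and g: "vanishing (M + 3) g"
  shows "g \<in> I"
proof -
  have split: "\<exists>x y. vanishing k x \<and> vanishing k y \<and> h = l * x + l' * y" if "vanishing (Suc k) h" for k h
    using vanishing_split_two_lines[OF ne that l] by metis
  obtain x y where xy: "vanishing (M + 2) x" "vanishing (M + 2) y" "g = l * x + l' * y"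
    using split[of "M + 2" g] g by (auto simp: numeral_3_eq_3)
  obtain x1 x2 where x: "vanishing (M + 1) x1" "vanishing (M + 1) x2" "x = l * x1 + l' * x2"
    using split[of "M + 1" x] xy by auto
  obtain y1 y2 where y: "vanishing (M + 1) y1" "vanishing (M + 1) y2" "y = l * y1 + l' * y2"
    using split[of "M + 1" y] xy by auto
  obtain x3 x4 where x2: "vanishing M x3" "vanishing M x4" "x2 = l * x3 + l' * x4"
    using split[of M x2] x by auto
  obtain y3 y4 where y1: "vanishing M y3" "vanishing M y4" "y1 = l * y3 + l' * y4"
    using split[of M y1] y by auto
  have "g = l * l * (x1 + l' * x3 + l' * y3) + l' * l' * (y2 + l * x4 + l * y4)"
    unfolding xy(3) x(3) y(3) x2(3) y1(3) by (simp add: algebra_simps)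
  moreover have "vanishing M (x1 + l' * x3 + l' * y3)" "vanishing M (y2 + l * x4 + l * y4)"
    using x y x2 y1 by (auto intro!: vanishing_add vanishing_mult_right intro: vanishing_mono)
  ultimately show ?thesis using local_ideal_add[OF I] sq by metis
qed

lemma coef_prod_00: "coef (\<Prod>x\<in>X. F x) 0 0 = (\<Prod>x\<in>X. coef (F x) 0 0)"
  by (induction X rule: infinite_finite_induct) (simp_all add: coef_1 coef_mult_00)

text \<open>Induction on the number of factors.  If two factors are lines through the origin, then each of
  them may be removed at the cost of its square, by \<open>tjurina_ideal_times_factor\<close>, and the two
  squares contain the cube of the maximal ideal.  If there is at most one such factor, the curve
  is empty or smooth at the origin, and the Tjurina ideal contains a unit.\<close>

lemma tjurina_ideal_contains_vanishing:
  assumes "finite X"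
    and F: "\<And>x. x \<in> X \<Longrightarrow> F x = emb (c x) + emb (a x) * U + emb (b x) * V"
    and ne: "\<And>x. x \<in> X \<Longrightarrow> c x = 0 \<Longrightarrow> a x \<noteq> 0 \<or> b x \<noteq> 0"
    and ind: "\<And>x y. x \<in> X \<Longrightarrow> y \<in> X \<Longrightarrow> x \<noteq> y \<Longrightarrow> c x = 0 \<Longrightarrow> c y = 0 \<Longrightarrow> a x * b y - a y * b x \<noteq> 0"
  shows "\<exists>M. \<forall>g. vanishing M g \<longrightarrow> g \<in> tjurina_ideal (\<Prod>x\<in>X. F x)"
  using assms
proof (induction X rule: finite_psubset_induct)
  case (psubset X)
  let ?P = "\<Prod>x\<in>X. F x"
  have F00: "coef (F x) 0 0 = c x" if "x \<in> X" for x
    using psubset.prems(1)[OF that] by (simp add: coef_emb coef_U coef_V)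
  have prem: "\<exists>M. \<forall>g. vanishing M g \<longrightarrow> g \<in> tjurina_ideal (\<Prod>x\<in>X - {z}. F x)" if "z \<in> X" for z
    using that psubset.prems by (intro psubset.IH) auto
  show ?case
  proof (cases "\<exists>x\<in>X. \<exists>y\<in>X. x \<noteq> y \<and> c x = 0 \<and> c y = 0")
    case True
    then obtain x y where xy: "x \<in> X" "y \<in> X" "x \<noteq> y" "c x = 0" "c y = 0" by blast
    obtain M M' where M: "\<forall>g. vanishing M g \<longrightarrow> g \<in> tjurina_ideal (\<Prod>z\<in>X - {x}. F z)"
      "\<forall>g. vanishing M' g \<longrightarrow> g \<in> tjurina_ideal (\<Prod>z\<in>X - {y}. F z)"
      using prem[OF xy(1)] prem[OF xy(2)] by (elim exE)
    have P: "?P = F x * (\<Prod>z\<in>X - {x}. F z)" "?P = F y * (\<Prod>z\<in>X - {y}. F z)"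
      using psubset.hyps xy by (auto intro: prod.remove)
    have "g \<in> tjurina_ideal ?P" if "vanishing (max M M' + 3) g" for g
    proof (rule vanishing_subset_two_squares[OF local_ideal_tjurina _ _ _ _ _ that])
      show "a x * b y - a y * b x \<noteq> 0" using psubset.prems(3) xy by blast
      show "F x = emb (a x) * U + emb (b x) * V" "F y = emb (a y) * U + emb (b y) * V"
        using psubset.prems(1) xy by (simp_all add: ring_hom_emb)
    next
      fix h assume h: "vanishing (max M M') h"
      hence "vanishing M h" "vanishing M' h" by (auto intro: vanishing_mono)
      hence "h \<in> tjurina_ideal (\<Prod>z\<in>X - {x}. F z)" "h \<in> tjurina_ideal (\<Prod>z\<in>X - {y}. F z)"
        using M by blast+
      thus "F x * F x * h \<in> tjurina_ideal ?P" "F y * F y * h \<in> tjurina_ideal ?P"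
        using tjurina_ideal_times_factor P by metis+
    qed
    thus ?thesis by blast
  next
    case False
    have "\<exists>u\<in>tjurina_ideal ?P. coef u 0 0 \<noteq> 0"
    proof (cases "\<exists>x\<in>X. c x = 0")
      case True
      then obtain x where x: "x \<in> X" "c x = 0" by blast
      let ?Q = "\<Prod>z\<in>X - {x}. F z"
      have P: "?P = F x * ?Q" using psubset.hyps x by (auto intro: prod.remove)
      have Q: "coef ?Q 0 0 \<noteq> 0"
        unfolding coef_prod_00 using False x F00 psubset.hyps by auto
      have Fx: "F x = emb (a x) * U + emb (b x) * V"
        using psubset.prems(1) x by (simp add: ring_hom_emb)
      have "coef (deriv_U ?P) 0 0 = a x * coef ?Q 0 0" "coef (deriv_V ?P) 0 0 = b x * coef ?Q 0 0"
        unfolding P deriv_U_mult deriv_V_mult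
        by (simp_all add: coef_mult_00 coef_deriv_U coef_deriv_V Fx coef_U coef_V)
      moreover have "a x \<noteq> 0 \<or> b x \<noteq> 0" using psubset.prems(2) x by blast
      ultimately show ?thesis using Q tjurina_ideal_gens(2,3)[of ?P] by (metis mult_eq_0_iff)
    next
      case no_zero: False
      hence "coef ?P 0 0 \<noteq> 0"
        unfolding coef_prod_00 using F00 psubset.hyps by auto
      thus ?thesis using tjurina_ideal_gens(1) by blast
    qed
    thus ?thesis using local_ideal_unit[OF local_ideal_tjurina] by blast
  qed
qed

definition uv_monomial :: "nat \<Rightarrow> nat \<Rightarrow> local_ring" where
  "uv_monomial i j = U ^ i * V ^ j"

lemma coef_uv_monomial: "coef (uv_monomial i j) i' j' = (if i' = i \<and> j' = j then 1 else 0)"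
proof -
  have U: "coef (U ^ i * g) i' j' = (if i \<le> i' then coef g (i' - i) j' else 0)" for g i i' j'
    by (induction i arbitrary: i') (auto simp: coef_U_mult mult.assoc)
  have V: "coef (V ^ j * g) i' j' = (if j \<le> j' then coef g i' (j' - j) else 0)" for g i' j j'
    by (induction j arbitrary: j') (auto simp: coef_V_mult mult.assoc)
  have "coef (U ^ i * (V ^ j * 1)) i' j' = (if i' = i \<and> j' = j then 1 else 0)"
    unfolding U V by (auto simp: coef_1)
  thus ?thesis by (simp add: uv_monomial_def)
qed

lemma uv_monomial_eq_iff: "uv_monomial i j = uv_monomial i' j' \<longleftrightarrow> i = i' \<and> j = j'"
  by (metis coef_uv_monomial one_neq_zero)

text \<open>The exponents of the monomials that form a basis modulo the N-th power of the maximal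
  ideal.\<close>

definition below :: "nat \<Rightarrow> (nat \<times> nat) set" where
  "below N = {(i, j). i + j < N}"

lemma finite_below: "finite (below N)"
  by (rule finite_subset[of _ "{..<N} \<times> {..<N}"]) (auto simp: below_def)

lemma card_below: "2 * card (below N) = N * (N + 1)"
proof -
  have "below N = (SIGMA i:{..<N}. {..<N - i})" by (auto simp: below_def)
  hence "card (below N) = (\<Sum>i<N. N - i)" by simp
  also have "\<dots> = (\<Sum>i<N. Suc (N - Suc i))" by (rule sum.cong) auto
  also have "\<dots> = (\<Sum>i<N. Suc i)" by (rule sum.nat_diff_reindex)
  finally have "card (below N) = (\<Sum>i<N. Suc i)" .
  moreover have "2 * (\<Sum>i<N. Suc i) = N * (N + 1)" by (induction N) auto
  ultimately show ?thesis by simp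
qed

lemma inj_uv_monomial: "inj_on (\<lambda>(i, j). uv_monomial i j) X"
  by (auto simp: inj_on_def uv_monomial_eq_iff)

definition trunc :: "nat \<Rightarrow> local_ring \<Rightarrow> local_ring" where
  "trunc N g = (\<Sum>(i, j)\<in>below N. emb (coef g i j) * uv_monomial i j)"

lemma coef_trunc: "coef (trunc N g) i j = (if i + j < N then coef g i j else 0)"
proof -
  have "coef (trunc N g) i j = (\<Sum>p\<in>below N. if p = (i, j) then coef g i j else 0)"
    by (simp add: trunc_def case_prod_beta coef_uv_monomial) (rule sum.cong, auto)
  thus ?thesis using finite_below by (simp add: below_def)
qed

lemma vanishing_minus_trunc: "vanishing N (g - trunc N g)"
  by (simp add: vanishing_def coef_trunc)

section \<open>Bases of quotients of finite dimension\<close>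

text \<open>The part of \<open>quotient_basis\<close> that asserts existence of coefficients, without uniqueness.\<close>

definition spans_quotient :: "local_ring set \<Rightarrow> local_ring set \<Rightarrow> bool" where
  "spans_quotient I B \<longleftrightarrow> finite B \<and>
     (\<forall>h. \<exists>c. (\<forall>b. b \<notin> B \<longrightarrow> c b = 0) \<and> h - (\<Sum>b\<in>B. emb (c b) * b) \<in> I)"

text \<open>The monomials of degree less than M span the quotient; a spanning set with the least number of
  elements is a basis.\<close>

lemma quotient_basis_exists:
  assumes I: "local_ideal I" and M: "\<And>g. vanishing M g \<Longrightarrow> g \<in> I"
  shows "\<exists>B. quotient_basis I B"
proof -
  let ?m = "\<lambda>(i, j). uv_monomial i j"
  have "spans_quotient I (?m ` below M)"
    unfolding spans_quotient_def
  proof (intro conjI allI)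
    fix h
    define c where "c = (\<lambda>b. if b \<in> ?m ` below M then case the_inv_into (below M) ?m b of (i, j) \<Rightarrow> coef h i j else 0)"
    have "(\<Sum>b\<in>?m ` below M. emb (c b) * b) = (\<Sum>p\<in>below M. emb (c (?m p)) * ?m p)"
      by (rule sum.reindex_cong[OF inj_uv_monomial refl]) simp
    also have "\<dots> = trunc M h"
      unfolding trunc_def
    proof (rule sum.cong[OF refl])
      fix p assume "p \<in> below M"
      thus "emb (c (?m p)) * ?m p = (case p of (i, j) \<Rightarrow> emb (coef h i j) * uv_monomial i j)"
        using the_inv_into_f_f[OF inj_uv_monomial, of p "below M"] by (auto simp: c_def split: prod.splits)
    qed
    finally have "h - (\<Sum>b\<in>?m ` below M. emb (c b) * b) \<in> I"
      using M vanishing_minus_trunc by simp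
    moreover have "\<forall>b. b \<notin> ?m ` below M \<longrightarrow> c b = 0" by (simp add: c_def)
    ultimately show "\<exists>c. (\<forall>b. b \<notin> ?m ` below M \<longrightarrow> c b = 0) \<and> h - (\<Sum>b\<in>?m ` below M. emb (c b) * b) \<in> I"
      by blast
  qed (simp add: finite_below)
  then obtain B where B: "spans_quotient I B" "\<And>B'. spans_quotient I B' \<Longrightarrow> card B \<le> card B'"
    using ex_has_least_nat[of "spans_quotient I" _ card] by blast
  have finB: "finite B" using B(1) by (simp add: spans_quotient_def)
  have unique: "c = c'" if c: "\<forall>b. b \<notin> B \<longrightarrow> c b = 0" "h - (\<Sum>b\<in>B. emb (c b) * b) \<in> I"
    and c': "\<forall>b. b \<notin> B \<longrightarrow> c' b = 0" "h - (\<Sum>b\<in>B. emb (c' b) * b) \<in> I" for c c' h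
  proof (rule ccontr)
    assume "c \<noteq> c'"
    then obtain b0 where b0: "c b0 \<noteq> c' b0" by blast
    hence b0B: "b0 \<in> B" using c c' by metis
    define e where "e b = c b - c' b" for b
    have "(h - (\<Sum>b\<in>B. emb (c' b) * b)) + emb (-1) * (h - (\<Sum>b\<in>B. emb (c b) * b)) \<in> I"
      using c c' local_ideal_add[OF I] local_ideal_mult[OF I] by blast
    also have "(h - (\<Sum>b\<in>B. emb (c' b) * b)) + emb (-1) * (h - (\<Sum>b\<in>B. emb (c b) * b))
        = (\<Sum>b\<in>B. emb (e b) * b)"
      by (rule local_ring_eqI) (simp add: e_def left_diff_distrib sum_subtractf)
    finally have rel: "(\<Sum>b\<in>B. emb (e b) * b) \<in> I" .
    have e0: "e b0 \<noteq> 0" using b0 by (simp add: e_def)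
    \<comment> \<open>The relation with coefficients e expresses b0 through the other elements modulo I.\<close>
    have "spans_quotient I (B - {b0})"
      unfolding spans_quotient_def
    proof (intro conjI allI)
      fix g
      obtain d where d: "\<forall>b. b \<notin> B \<longrightarrow> d b = 0" "g - (\<Sum>b\<in>B. emb (d b) * b) \<in> I"
        using B(1) unfolding spans_quotient_def by blast
      define t where "t = d b0 / e b0"
      define d' where "d' b = d b - t * e b" for b
      have d'0: "d' b0 = 0" using e0 by (simp add: d'_def t_def)
      have "(\<Sum>b\<in>B - {b0}. emb (d' b) * b) = (\<Sum>b\<in>B. emb (d' b) * b)"
        by (rule sum.mono_neutral_left) (use finB d'0 in \<open>auto simp: ring_hom_emb\<close>)
      hence "g - (\<Sum>b\<in>B - {b0}. emb (d' b) * b) =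
          (g - (\<Sum>b\<in>B. emb (d b) * b)) + emb t * (\<Sum>b\<in>B. emb (e b) * b)"
        by (intro local_ring_eqI) (simp add: d'_def left_diff_distrib sum_subtractf sum_distrib_left mult.assoc)
      also have "\<dots> \<in> I" using d(2) rel local_ideal_add[OF I] local_ideal_mult[OF I] by blast
      finally have "g - (\<Sum>b\<in>B - {b0}. emb (d' b) * b) \<in> I" .
      moreover have "\<forall>b. b \<notin> B - {b0} \<longrightarrow> d' b = 0"
        using d(1) c(1) c'(1) d'0 by (auto simp: d'_def e_def)
      ultimately show "\<exists>c. (\<forall>b. b \<notin> B - {b0} \<longrightarrow> c b = 0) \<and> g - (\<Sum>b\<in>B - {b0}. emb (c b) * b) \<in> I"
        by blast
    qed (use finB in simp)
    hence "card B \<le> card (B - {b0})" by (rule B(2))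
    thus False using finB b0B by (metis card_Diff1_less not_le)
  qed
  have "quotient_basis I B"
    unfolding quotient_basis_def
  proof (intro conjI allI ex_ex1I finB)
    fix h
    show "\<exists>c. (\<forall>b. b \<notin> B \<longrightarrow> c b = 0) \<and> h - (\<Sum>b\<in>B. emb (c b) * b) \<in> I"
      using B(1) unfolding spans_quotient_def by blast
  qed (use unique in blast)
  thus ?thesis ..
qed

lemma vector_space_local: "vector_space (\<lambda>c (g :: local_ring). emb c * g)"
  by unfold_locales (simp_all add: ring_hom_emb algebra_simps)

text \<open>Work modulo the power \<open>N = 2 k\<close> of the maximal ideal.  The space of all series has the
  \<open>k (2 k + 1)\<close> monomials of degree less than N as a basis.  It is spanned by B and by the products
  of P and of Q with the \<open>k (k + 1) / 2\<close> monomials of degree less than k, as products with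
  monomials of higher degree vanish to order N.\<close>

lemma card_spanning_ge:
  assumes B: "spans_quotient I B" and I: "\<And>x. x \<in> I \<Longrightarrow> \<exists>a b. x = a * P + b * Q"
    and PQ: "vanishing k P" "vanishing k Q"
  shows "k\<^sup>2 \<le> card B"
proof -
  interpret vs: vector_space "\<lambda>c (g :: local_ring). emb c * g" by (rule vector_space_local)
  let ?m = "\<lambda>(i, j). uv_monomial i j" and ?N = "2 * k"
  have finB: "finite B" using B by (simp add: spans_quotient_def)
  define W where "W = trunc ?N ` B \<union> (\<lambda>p. trunc ?N (?m p * P)) ` below k
      \<union> (\<lambda>p. trunc ?N (?m p * Q)) ` below k"
  have finW: "finite W" using finB finite_below by (simp add: W_def)
  have cardW: "card W \<le> card B + card (below k) + card (below k)"
    unfolding W_def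
    by (intro order_trans[OF card_Un_le] add_mono card_image_le finB finite_below)
  have tr_add: "trunc ?N (x + y) = trunc ?N x + trunc ?N y" for x y
    by (rule local_ring_eqI) (simp add: coef_trunc)
  have tr_scale: "trunc ?N (emb c * x) = emb c * trunc ?N x" for c x
    by (rule local_ring_eqI) (simp add: coef_trunc)
  have tr_sum: "trunc ?N (\<Sum>x\<in>X. F x) = (\<Sum>x\<in>X. trunc ?N (F x))" for X :: "'x set" and F
    by (rule local_ring_eqI) (simp add: coef_trunc)
  have tr_0: "trunc ?N x = 0" if "vanishing ?N x" for x
    by (rule local_ring_eqI) (use that in \<open>simp add: coef_trunc vanishing_def\<close>)
  have mult_span: "trunc ?N (a * R) \<in> vs.span W"
    if R: "vanishing k R" "\<And>p. p \<in> below k \<Longrightarrow> trunc ?N (?m p * R) \<in> W" for a R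
  proof -
    have "a * R = (\<Sum>p\<in>below k. emb (coef a (fst p) (snd p)) * (?m p * R)) + (a - trunc k a) * R"
      by (simp add: trunc_def case_prod_beta sum_distrib_right left_diff_distrib mult.assoc)
    moreover have "trunc ?N ((a - trunc k a) * R) = 0"
      using vanishing_mult[OF vanishing_minus_trunc R(1)] by (intro tr_0) (simp add: mult_2)
    ultimately have "trunc ?N (a * R) =
        (\<Sum>p\<in>below k. emb (coef a (fst p) (snd p)) * trunc ?N (?m p * R))"
      by (simp add: tr_add tr_sum tr_scale)
    also have "\<dots> \<in> vs.span W"
      by (intro vs.span_sum vs.span_scale vs.span_base R(2))
    finally show ?thesis .
  qed
  have span: "trunc ?N h \<in> vs.span W" for h
  proof -
    obtain c where "h - (\<Sum>b\<in>B. emb (c b) * b) \<in> I" using B unfolding spans_quotient_def by blast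
    then obtain a b where "h - (\<Sum>b\<in>B. emb (c b) * b) = a * P + b * Q" using I by blast
    hence "h = (\<Sum>b\<in>B. emb (c b) * b) + (a * P + b * Q)" by (simp add: algebra_simps)
    hence "trunc ?N h = (\<Sum>b\<in>B. emb (c b) * trunc ?N b) + (trunc ?N (a * P) + trunc ?N (b * Q))"
      by (simp only: tr_add tr_sum tr_scale)
    also have "\<dots> \<in> vs.span W"
      by (intro vs.span_add vs.span_sum vs.span_scale mult_span PQ) (auto intro: vs.span_base simp: W_def)
    finally show ?thesis .
  qed
  have "vs.independent (?m ` below ?N)"
  proof (rule vs.independent_if_scalars_zero)
    fix u x assume z: "(\<Sum>x\<in>?m ` below ?N. emb (u x) * x) = 0" and x: "x \<in> ?m ` below ?N"
    obtain i j where ij: "(i, j) \<in> below ?N" "x = uv_monomial i j" using x by auto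
    have "(\<Sum>x\<in>?m ` below ?N. emb (u x) * x) = (\<Sum>p\<in>below ?N. emb (u (?m p)) * ?m p)"
      by (rule sum.reindex_cong[OF inj_uv_monomial refl]) simp
    hence "0 = coef (\<Sum>p\<in>below ?N. emb (u (?m p)) * ?m p) i j" using z by simp
    also have "\<dots> = (\<Sum>p\<in>below ?N. if p = (i, j) then u x else 0)"
      by (simp add: case_prod_beta coef_uv_monomial) (rule sum.cong, auto simp: ij(2))
    also have "\<dots> = u x" using ij(1) finite_below[of ?N] by (simp add: sum.delta)
    finally show "u x = 0" ..
  qed (simp add: finite_below)
  moreover have "?m ` below ?N \<subseteq> vs.span W"
  proof
    fix x assume "x \<in> ?m ` below ?N"
    then obtain i j where "(i, j) \<in> below ?N" "x = uv_monomial i j" by auto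
    hence "trunc ?N x = x"
      by (intro local_ring_eqI) (auto simp: coef_trunc coef_uv_monomial below_def)
    thus "x \<in> vs.span W" using span[of x] by simp
  qed
  ultimately have "card (?m ` below ?N) \<le> card W"
    using vs.independent_span_bound[OF finW] by blast
  hence "card (below ?N) \<le> card B + 2 * card (below k)"
    using cardW by (simp add: card_image[OF inj_uv_monomial])
  moreover have "2 * card (below ?N) = ?N * (?N + 1)" "2 * card (below k) = k * (k + 1)"
    by (rule card_below)+
  ultimately show ?thesis by (simp add: power2_eq_square algebra_simps)
qed

text \<open>The Euler operator \<open>U \<partial>\<^sub>U + V \<partial>\<^sub>V\<close> is a derivation that fixes linear forms.\<close>

lemma euler_local:
  assumes "finite X" "\<And>x. x \<in> X \<Longrightarrow> F x = emb (a x) * U + emb (b x) * V"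
  shows "U * deriv_U (\<Prod>x\<in>X. F x) + V * deriv_V (\<Prod>x\<in>X. F x) = emb (of_nat (card X)) * (\<Prod>x\<in>X. F x)"
    and "vanishing (card X) (\<Prod>x\<in>X. F x)"
proof -
  have F: "U * deriv_U (F x) + V * deriv_V (F x) = F x" "vanishing 1 (F x)" if "x \<in> X" for x
  proof -
    have "deriv_U (F x) = emb (a x)" "deriv_V (F x) = emb (b x)"
      unfolding assms(2)[OF that]
      by (rule local_ring_eqI, simp add: coef_deriv_U coef_deriv_V coef_U coef_V coef_emb)+
    thus "U * deriv_U (F x) + V * deriv_V (F x) = F x" using assms(2)[OF that] by (simp add: mult.commute)
    show "vanishing 1 (F x)"
      unfolding assms(2)[OF that] by (simp add: vanishing_def coef_U coef_V)
  qed
  have one: "U * deriv_U 1 + V * deriv_V 1 = 0"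
    by (rule local_ring_eqI) (simp add: coef_U_mult coef_V_mult coef_deriv_U coef_deriv_V coef_1)
  from assms(1) F
  have "U * deriv_U (\<Prod>x\<in>X. F x) + V * deriv_V (\<Prod>x\<in>X. F x) = emb (of_nat (card X)) * (\<Prod>x\<in>X. F x)
    \<and> vanishing (card X) (\<Prod>x\<in>X. F x)"
  proof (induction X rule: finite_induct)
    case empty
    show ?case using one by (simp add: ring_hom_emb)
  next
    case (insert x X)
    let ?h = "\<Prod>x\<in>X. F x"
    have "U * deriv_U (F x * ?h) + V * deriv_V (F x * ?h) =
        (U * deriv_U (F x) + V * deriv_V (F x)) * ?h + F x * (U * deriv_U ?h + V * deriv_V ?h)"
      unfolding deriv_U_mult deriv_V_mult by (simp add: algebra_simps)
    also have "\<dots> = F x * ?h + F x * (emb (of_nat (card X)) * ?h)"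
      using insert by simp
    finally show ?case using insert vanishing_mult[of 1 "F x" "card X" ?h]
      by (simp add: ring_hom_emb algebra_simps)
  qed
  thus "U * deriv_U (\<Prod>x\<in>X. F x) + V * deriv_V (\<Prod>x\<in>X. F x) = emb (of_nat (card X)) * (\<Prod>x\<in>X. F x)"
    and "vanishing (card X) (\<Prod>x\<in>X. F x)" by blast+
qed

text \<open>The factors with \<open>c x = 0\<close> are the lines through the origin; let h be their product and u that
  of the others.  All of \<open>u h\<close> and its derivatives lie in the ideal generated by h and its
  derivatives, and h is itself in the ideal of its derivatives by Euler's identity.\<close>

lemma tjurina_number_ge:
  assumes X: "finite X"
    and F: "\<And>x. x \<in> X \<Longrightarrow> F x = emb (c x) + emb (a x) * U + emb (b x) * V"
    and ne: "\<And>x. x \<in> X \<Longrightarrow> c x = 0 \<Longrightarrow> a x \<noteq> 0 \<or> b x \<noteq> 0"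
    and ind: "\<And>x y. x \<in> X \<Longrightarrow> y \<in> X \<Longrightarrow> x \<noteq> y \<Longrightarrow> c x = 0 \<Longrightarrow> c y = 0 \<Longrightarrow> a x * b y - a y * b x \<noteq> 0"
  shows "(card {x \<in> X. c x = 0} - 1)\<^sup>2 \<le> quotient_dim (tjurina_ideal (\<Prod>x\<in>X. F x))"
proof -
  let ?T = "tjurina_ideal (\<Prod>x\<in>X. F x)" and ?Y = "{x \<in> X. c x = 0}"
  obtain M where "\<And>g. vanishing M g \<Longrightarrow> g \<in> ?T"
    using tjurina_ideal_contains_vanishing[of X F c a b] X F ne ind by blast
  hence "\<exists>B. quotient_basis ?T B" by (rule quotient_basis_exists[OF local_ideal_tjurina])
  hence "quotient_basis ?T (SOME B. quotient_basis ?T B)" by (rule someI_ex)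
  moreover define B where "B = (SOME B. quotient_basis ?T B)"
  ultimately have "quotient_basis ?T B" by simp
  hence B: "spans_quotient ?T B"
    unfolding quotient_basis_def spans_quotient_def by blast
  show ?thesis
  proof (cases "card ?Y = 0")
    case False
    then obtain k where k: "card ?Y = Suc k" by (cases "card ?Y") auto
    let ?h = "\<Prod>x\<in>?Y. F x" and ?u = "\<Prod>x\<in>X - ?Y. F x"
    let ?P = "deriv_U ?h" and ?Q = "deriv_V ?h"
    have FY: "F x = emb (a x) * U + emb (b x) * V" if "x \<in> ?Y" for x
      using F that by (simp add: ring_hom_emb)
    have finY: "finite ?Y" using X by simp
    have split: "(\<Prod>x\<in>X. F x) = ?u * ?h" using X by (intro prod.subset_diff) auto
    have h: "?h = emb (inverse (of_nat (Suc k))) * (U * ?P + V * ?Q)"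
    proof -
      have "emb (inverse (of_nat (Suc k))) * (emb (of_nat (Suc k)) * ?h) = ?h"
        by (simp add: mult.assoc[symmetric] ring_hom_emb(2) flip: ring_hom_emb(4) del: of_nat_Suc)
      thus ?thesis using euler_local(1)[of ?Y F a b, OF finY FY] k by simp
    qed
    have gens: "\<exists>p q. x = p * ?P + q * ?Q" if x: "x \<in> ?T" for x
    proof -
      obtain r s t where "x = r * (?u * ?h) + s * deriv_U (?u * ?h) + t * deriv_V (?u * ?h)"
        using x unfolding split tjurina_ideal_def by blast
      moreover define w where "w = r * ?u + s * deriv_U ?u + t * deriv_V ?u"
      ultimately have "x = w * ?h + (s * ?u) * ?P + (t * ?u) * ?Q"
        unfolding deriv_U_mult deriv_V_mult by (simp add: algebra_simps)
      moreover define z where "z = emb (inverse (of_nat (Suc k)))"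
      have "w * ?h = w * (z * (U * ?P + V * ?Q))"
        using arg_cong[OF h, of "\<lambda>y. w * y"] unfolding z_def .
      ultimately have "x = w * (z * (U * ?P + V * ?Q)) + (s * ?u) * ?P + (t * ?u) * ?Q"
        by (simp only:)
      hence "x = (w * z * U + s * ?u) * ?P + (w * z * V + t * ?u) * ?Q"
        by (simp add: algebra_simps)
      thus ?thesis by blast
    qed
    have van: "vanishing (Suc k) ?h" using euler_local(2)[of ?Y F a b, OF finY FY] unfolding k .
    have "k\<^sup>2 \<le> card B"
      by (rule card_spanning_ge[OF B gens vanishing_deriv(1)[OF van] vanishing_deriv(2)[OF van]])
    thus ?thesis using k by (simp add: quotient_dim_def B_def)
  qed simp
qed

section \<open>Singular points of a line arrangement\<close>

lemma add_mult_unique: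
  fixes a b x y N :: nat
  assumes "a < N" "b < N" "a + N * x = b + N * y"
  shows "a = b \<and> x = y"
proof -
  have "(a + N * x) mod N = a" "(b + N * y) mod N = b" using assms(1,2) by simp_all
  hence "a = b" using assms(3) by simp
  thus ?thesis using assms by simp
qed

lemma prod_UNIV_3: "prod g (UNIV :: 3 set) = g 1 * g 2 * g 3"
  unfolding UNIV_3 by (simp add: mult.assoc)

text \<open>Kronecker substitution: on the curve \<open>(t, t ^ N, t ^ (N * N))\<close> with N larger than all exponents,
  different monomials become different powers of t.\<close>

lemma eval_eq_0_imp_zero:
  assumes g: "homogeneous q g" and z: "\<And>v. eval g v = 0"
  shows "g = 0"
proof (rule ccontr)
  assume "g \<noteq> 0"
  then obtain m where m: "m \<in> Poly_Mapping.keys g" by (metis all_not_in_conv keys_eq_empty)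
  define N where "N = Suc q"
  define \<phi> :: "(3 \<Rightarrow>\<^sub>0 nat) \<Rightarrow> nat" where
    "\<phi> m = Poly_Mapping.lookup m 1 + N * (Poly_Mapping.lookup m 2 + N * Poly_Mapping.lookup m 3)" for m
  have less: "Poly_Mapping.lookup k i < N" if "k \<in> Poly_Mapping.keys g" for k i
  proof -
    have "Poly_Mapping.lookup k i \<le> (\<Sum>i\<in>UNIV. Poly_Mapping.lookup k i)"
      by (rule member_le_sum) auto
    thus ?thesis using g that by (simp add: homogeneous_def N_def)
  qed
  have inj: "k = k'" if k: "k \<in> Poly_Mapping.keys g" "k' \<in> Poly_Mapping.keys g" "\<phi> k = \<phi> k'" for k k'
  proof -
    note digits = add_mult_unique[OF less[OF k(1)] less[OF k(2)]]
    have "Poly_Mapping.lookup k 1 = Poly_Mapping.lookup k' 1"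
      and 2: "Poly_Mapping.lookup k 2 + N * Poly_Mapping.lookup k 3 =
              Poly_Mapping.lookup k' 2 + N * Poly_Mapping.lookup k' 3"
      using digits k(3) unfolding \<phi>_def by blast+
    moreover have "Poly_Mapping.lookup k 2 = Poly_Mapping.lookup k' 2"
      "Poly_Mapping.lookup k 3 = Poly_Mapping.lookup k' 3"
      using digits[OF 2] by blast+
    ultimately have "Poly_Mapping.lookup k i = Poly_Mapping.lookup k' i" for i
      using exhaust_3[of i] by auto
    thus ?thesis by (rule poly_mapping_eqI)
  qed
  define p where "p = (\<Sum>k\<in>Poly_Mapping.keys g. Polynomial.monom (Poly_Mapping.lookup g k) (\<phi> k))"
  have "poly p t = eval g (\<chi> i. if i = 1 then t else if i = 2 then t ^ N else t ^ (N * N))" for t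
    unfolding p_def eval_def subst_def poly_sum poly_monom
  proof (rule sum.cong[OF refl])
    fix k
    have "t ^ \<phi> k = t ^ Poly_Mapping.lookup k 1 * (t ^ N) ^ Poly_Mapping.lookup k 2
        * (t ^ (N * N)) ^ Poly_Mapping.lookup k 3"
      by (simp add: \<phi>_def power_add power_mult[symmetric] algebra_simps)
    also have "\<dots> = (\<Prod>i\<in>UNIV.
        (\<chi> i. if i = 1 then t else if i = 2 then t ^ N else t ^ (N * N)) $ i ^ Poly_Mapping.lookup k i)"
      by (simp add: prod_UNIV_3)
    finally show "Poly_Mapping.lookup g k * t ^ \<phi> k = Poly_Mapping.lookup g k * (\<Prod>i\<in>UNIV.
        (\<chi> i. if i = 1 then t else if i = 2 then t ^ N else t ^ (N * N)) $ i ^ Poly_Mapping.lookup k i)"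
      by (rule arg_cong)
  qed
  hence "\<forall>t. poly p t = 0" using z by simp
  hence "p = 0" by (simp only: poly_all_0_iff_0)
  hence "0 = coeff p (\<phi> m)" by simp
  also have "\<dots> = (\<Sum>k\<in>Poly_Mapping.keys g. if k = m then Poly_Mapping.lookup g k else 0)"
    unfolding p_def coeff_sum by (rule sum.cong[OF refl]) (use inj m in auto)
  also have "\<dots> = Poly_Mapping.lookup g m" using m by simp
  finally show False using m by (simp add: in_keys_iff)
qed

lemma line_arrangement_linear:
  "line_arrangement A \<Longrightarrow> l \<in> A \<Longrightarrow> homogeneous 1 l"
  by (simp add: line_arrangement_def)

lemma line_arrangement_finite: "line_arrangement A \<Longrightarrow> finite A"
  by (simp add: line_arrangement_def)

lemma normal_vec_nonzero:
  assumes "line_arrangement A" "l \<in> A"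
  shows "normal_vec l \<noteq> 0"
proof
  assume "normal_vec l = 0"
  hence "l = const 0 * l"
    using normal_vec_inject_scaled[of l l 0] line_arrangement_linear[OF assms] by simp
  hence "l = 0" by (simp add: const_def)
  thus False using assms unfolding line_arrangement_def by blast
qed

lemma cross_normal_vec:
  assumes "line_arrangement A" "l \<in> A" "m \<in> A" "l \<noteq> m"
  shows "cross (normal_vec l) (normal_vec m) \<noteq> 0"
proof
  assume "cross (normal_vec l) (normal_vec m) = 0"
  then obtain c where "normal_vec m = c *s normal_vec l"
    using cross_eq_0_imp_scaled normal_vec_nonzero[OF assms(1,2)] by metis
  hence "m = const c * l"
    using normal_vec_inject_scaled line_arrangement_linear[OF assms(1)] assms by blast
  thus False using assms unfolding line_arrangement_def by blast
qed

lemma inj_on_normal_vec: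
  assumes "line_arrangement A"
  shows "inj_on normal_vec A"
proof (rule inj_onI, rule ccontr)
  fix l m assume "l \<in> A" "m \<in> A" "normal_vec l = normal_vec m" "l \<noteq> m"
  thus False using cross_normal_vec[OF assms, of l m] cross_scaled(2)[of "normal_vec l" 1] by simp
qed

lemma normals_arrangement:
  assumes "line_arrangement A"
  shows "normals (normal_vec ` A)"
  unfolding normals_def
proof (intro conjI ballI impI)
  show "0 \<notin> normal_vec ` A"
  proof
    assume "0 \<in> normal_vec ` A"
    then obtain l where "l \<in> A" "normal_vec l = 0" by force
    thus False using normal_vec_nonzero[OF assms] by blast
  qed
  show "finite (normal_vec ` A)" using line_arrangement_finite[OF assms] by simp
next
  fix n m assume "n \<in> normal_vec ` A" "m \<in> normal_vec ` A" "n \<noteq> m"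
  thus "cross n m \<noteq> 0" using cross_normal_vec[OF assms] by blast
qed

lemma vanishes_at_line_pts:
  assumes "line_arrangement A" "l \<in> A" "p \<in> P2"
  shows "vanishes_at l p \<longleftrightarrow> p \<in> line_pts (normal_vec l)"
  using eval_linear[OF line_arrangement_linear[OF assms(1,2)]] assms(3)
  by (simp add: vanishes_at_def line_pts_def)

lemma mult_at_eq_deg:
  assumes A: "line_arrangement A" and p: "p \<in> P2"
  shows "mult_at A p = deg line_pts (normal_vec ` A) p"
proof -
  have "{n \<in> normal_vec ` A. p \<in> line_pts n} = normal_vec ` {l \<in> A. vanishes_at l p}"
    using vanishes_at_line_pts[OF A _ p] by auto
  moreover have "inj_on normal_vec {l \<in> A. vanishes_at l p}"
    using inj_on_normal_vec[OF A] by (rule inj_on_subset) auto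
  ultimately show ?thesis by (simp add: mult_at_def deg_def card_image)
qed

lemma directional_derivative:
  assumes A: "line_arrangement A"
  shows "(\<Sum>i\<in>UNIV. D $ i * eval (pdiff i (\<Prod>A)) v) =
    (\<Sum>l\<in>A. dot (normal_vec l) D * (\<Prod>m\<in>A - {l}. eval m v))"
proof -
  have fin: "finite A" by (rule line_arrangement_finite[OF A])
  have "eval (pdiff i (\<Prod>A)) v = (\<Sum>l\<in>A. normal_vec l $ i * (\<Prod>m\<in>A - {l}. eval m v))" for i
  proof -
    have "eval (pdiff i (\<Prod>A)) v = (\<Sum>l\<in>A. eval (pdiff i l) v * (\<Prod>m\<in>A - {l}. eval m v))"
      using pdiff_prod[OF fin, of i "\<lambda>l. l"] by (simp add: eval_sum eval_mult eval_prod)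
    thus ?thesis using eval_pdiff_linear[OF line_arrangement_linear[OF A]] by simp
  qed
  hence "(\<Sum>i\<in>UNIV. D $ i * eval (pdiff i (\<Prod>A)) v) =
      (\<Sum>i\<in>UNIV. \<Sum>l\<in>A. D $ i * (normal_vec l $ i * (\<Prod>m\<in>A - {l}. eval m v)))"
    by (simp add: sum_distrib_left)
  also have "\<dots> = (\<Sum>l\<in>A. \<Sum>i\<in>UNIV. D $ i * (normal_vec l $ i * (\<Prod>m\<in>A - {l}. eval m v)))"
    by (rule sum.swap)
  also have "\<dots> = (\<Sum>l\<in>A. dot (normal_vec l) D * (\<Prod>m\<in>A - {l}. eval m v))"
    by (simp add: dot_def sum_distrib_left sum_distrib_right mult_ac)
  finally show ?thesis .
qed

lemma eval_pdiff_arrangement: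
  assumes A: "line_arrangement A"
  shows "eval (pdiff i (\<Prod>A)) v = (\<Sum>l\<in>A. normal_vec l $ i * (\<Prod>m\<in>A - {l}. eval m v))"
proof -
  have "(\<Sum>j\<in>UNIV. axis i 1 $ j * eval (pdiff j (\<Prod>A)) v) = eval (pdiff i (\<Prod>A)) v"
    by (simp add: axis_def if_distrib[of "\<lambda>x. x * _"] cong: if_cong)
  thus ?thesis using directional_derivative[OF A, of "axis i 1" v] by (simp add: dot_axis)
qed

lemma singular_points_eq_multiple:
  assumes A: "line_arrangement A"
  shows "singular_points (\<Prod>A) = multiple line_pts (normal_vec ` A)"
proof (intro subset_antisym subsetI)
  have fin: "finite A" by (rule line_arrangement_finite[OF A])
  fix p assume "p \<in> multiple line_pts (normal_vec ` A)"
  hence deg2: "2 \<le> card {n \<in> normal_vec ` A. p \<in> line_pts n}" by (simp add: multiple_def deg_def)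
  hence "{n \<in> normal_vec ` A. p \<in> line_pts n} \<noteq> {}" by fastforce
  hence p: "p \<in> P2" by (auto simp: line_pts_def)
  have "2 \<le> card {l \<in> A. vanishes_at l p}"
    using deg2 mult_at_eq_deg[OF A p] by (simp add: mult_at_def deg_def)
  then obtain T where T: "T \<subseteq> {l \<in> A. vanishes_at l p}" "card T = 2"
    by (meson obtain_subset_with_card_n)
  then obtain l m where lm: "l \<in> A" "m \<in> A" "l \<noteq> m" "vanishes_at l p" "vanishes_at m p"
    by (auto simp: card_2_iff)
  have "eval (\<Prod>A) w = 0" if "w \<in> p" for w
    using lm fin that eval_prod[where v = w and F = "\<lambda>x. x" and X = A]
    by (auto simp: vanishes_at_def)
  moreover have "eval (pdiff i (\<Prod>A)) w = 0" if w: "w \<in> p" for w i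
    unfolding eval_pdiff_arrangement[OF A]
  proof (intro sum.neutral ballI)
    fix x assume "x \<in> A"
    have "\<exists>y\<in>A - {x}. eval y w = 0"
      using lm w by (cases "x = l") (auto simp: vanishes_at_def)
    thus "normal_vec x $ i * (\<Prod>y\<in>A - {x}. eval y w) = 0" using fin by simp
  qed
  ultimately show "p \<in> singular_points (\<Prod>A)"
    using p by (simp add: singular_points_def curve_def vanishes_at_def)
next
  have fin: "finite A" by (rule line_arrangement_finite[OF A])
  fix p assume "p \<in> singular_points (\<Prod>A)"
  hence p: "p \<in> P2" "\<And>w. w \<in> p \<Longrightarrow> eval (\<Prod>A) w = 0" "\<And>i w. w \<in> p \<Longrightarrow> eval (pdiff i (\<Prod>A)) w = 0"
    by (auto simp: singular_points_def curve_def vanishes_at_def)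
  obtain v where v: "v \<noteq> 0" "p = vec.span {v}" using P2_cases[OF p(1)] .
  have vp: "v \<in> p" using v(2) by (simp add: vec.span_base)
  have van: "vanishes_at l p" if "l \<in> A" "eval l v = 0" for l
    using that vanishes_at_line_pts[OF A _ p(1)] span_in_line_pts[OF v(1)] v(2)
      eval_linear[OF line_arrangement_linear[OF A]] by simp
  have "(\<Prod>l\<in>A. eval l v) = 0"
    using p(2)[OF vp] eval_prod[where v = v and F = "\<lambda>x. x" and X = A] by simp
  then obtain l where l: "l \<in> A" "eval l v = 0" using fin by auto
  have "\<exists>m\<in>A. m \<noteq> l \<and> eval m v = 0"
  proof (rule ccontr)
    assume *: "\<not> ?thesis"
    have "normal_vec l $ i = 0" for i
    proof -
      have "0 = (\<Sum>x\<in>A. normal_vec x $ i * (\<Prod>y\<in>A - {x}. eval y v))"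
        using p(3)[OF vp] eval_pdiff_arrangement[OF A] by simp
      also have "\<dots> = normal_vec l $ i * (\<Prod>y\<in>A - {l}. eval y v)
          + (\<Sum>x\<in>A - {l}. normal_vec x $ i * (\<Prod>y\<in>A - {x}. eval y v))"
        by (rule sum.remove[OF fin l(1)])
      also have "(\<Sum>x\<in>A - {l}. normal_vec x $ i * (\<Prod>y\<in>A - {x}. eval y v)) = 0"
        using l fin by (intro sum.neutral ballI) auto
      finally have "normal_vec l $ i * (\<Prod>y\<in>A - {l}. eval y v) = 0" by simp
      moreover have "(\<Prod>y\<in>A - {l}. eval y v) \<noteq> 0" using * fin by auto
      ultimately show ?thesis by simp
    qed
    hence "normal_vec l = 0" by (simp add: vec_eq_iff)
    thus False using normal_vec_nonzero[OF A l(1)] by simp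
  qed
  then obtain m where m: "m \<in> A" "m \<noteq> l" "eval m v = 0" by blast
  have "card {l, m} \<le> card {x \<in> A. vanishes_at x p}"
    using van l m fin by (intro card_mono) auto
  hence "2 \<le> deg line_pts (normal_vec ` A) p"
    using m mult_at_eq_deg[OF A p(1)] by (simp add: mult_at_def)
  thus "p \<in> multiple line_pts (normal_vec ` A)" by (simp add: multiple_def)
qed

text \<open>In the chart at p, the equation of a line l becomes
  \<open>dot n v + n\<^sub>i\<^sub>+\<^sub>1 U + n\<^sub>i\<^sub>+\<^sub>2 V\<close>, where n is its normal vector and v the representative
  of p with \<open>v\<^sub>i = 1\<close>.  For two lines through p, the determinant of the coefficients of U and V
  is the i-th coordinate of the cross product of the normal vectors; v is a multiple of this
  product and \<open>v\<^sub>i = 1\<close>, so it is not zero.\<close>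

lemma tjurina_at_ge:
  assumes A: "line_arrangement A" and p: "p \<in> P2"
  shows "(mult_at A p - 1)\<^sup>2 \<le> tjurina_at (\<Prod>A) p"
proof -
  have fin: "finite A" by (rule line_arrangement_finite[OF A])
  obtain w where w: "w \<noteq> 0" "p = vec.span {w}" using P2_cases[OF p] .
  define i where "i = (SOME i. \<exists>v\<in>p. v $ i \<noteq> 0)"
  define v where "v = (THE v. v \<in> p \<and> v $ i = 1)"
  have "\<exists>i. \<exists>v\<in>p. v $ i \<noteq> 0"
    using w vec.span_base[of w "{w}"] by (auto simp: vec_eq_iff)
  hence "\<exists>v\<in>p. v $ i \<noteq> 0" unfolding i_def by (rule someI_ex)
  hence wi: "w $ i \<noteq> 0" using w(2) by (auto simp: vec.span_singleton)
  have v_eq: "v = inverse (w $ i) *s w"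
    unfolding v_def w(2) vec.span_singleton
    using wi by (intro the_equality) (auto simp: field_simps)
  hence v: "v $ i = 1" "p = vec.span {v}" "v \<noteq> 0"
  proof -
    show "v $ i = 1" using v_eq wi by simp
    thus "v \<noteq> 0" by auto
    show "p = vec.span {v}" using w(2) v_eq wi span_scaled[of "inverse (w $ i)" w] by simp
  qed
  define \<phi> :: "3 \<Rightarrow> local_ring" where
    "\<phi> j = (if j = i then 1 else if j = i + 1 then emb (v $ j) + U else emb (v $ j) + V)" for j
  have hom: "ring_hom_from_complex emb"
    by (simp add: ring_hom_from_complex_def ring_hom_emb)
  define F where "F l = subst emb \<phi> l" for l
  let ?n = normal_vec
  have F: "F l = emb (dot (?n l) v) + emb (?n l $ (i + 1)) * U + emb (?n l $ (i + 2)) * V"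
    if "l \<in> A" for l
  proof -
    have "F l = emb (?n l $ i) * \<phi> i + emb (?n l $ (i + 1)) * \<phi> (i + 1) + emb (?n l $ (i + 2)) * \<phi> (i + 2)"
      unfolding F_def subst_linear[OF hom line_arrangement_linear[OF A that]] sum_3
      using exhaust_3[of i] by (elim disjE) simp_all
    moreover have "\<phi> i = emb (v $ i)" "\<phi> (i + 1) = emb (v $ (i + 1)) + U" "\<phi> (i + 2) = emb (v $ (i + 2)) + V"
      using v(1) exhaust_3[of i] by (auto simp: \<phi>_def ring_hom_emb)
    moreover have "dot (?n l) v = ?n l $ i * v $ i + ?n l $ (i + 1) * v $ (i + 1) + ?n l $ (i + 2) * v $ (i + 2)"
      using exhaust_3[of i] by (elim disjE) (simp_all add: dot_simps)
    ultimately show ?thesis by (simp add: ring_hom_emb algebra_simps)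
  qed
  have ne: "?n l $ (i + 1) \<noteq> 0 \<or> ?n l $ (i + 2) \<noteq> 0" if "l \<in> A" "dot (?n l) v = 0" for l
  proof (rule ccontr)
    assume "\<not> ?thesis"
    hence z: "?n l $ (i + 1) = 0" "?n l $ (i + 2) = 0" by simp_all
    hence "?n l $ i = 0"
      using that(2) v(1) exhaust_3[of i] by (elim disjE) (simp_all add: dot_simps)
    with z have "?n l $ j = 0" for j
      using exhaust_3[of i] exhaust_3[of j] by (elim disjE) simp_all
    hence "?n l = 0" by (simp add: vec_eq_iff)
    thus False using normal_vec_nonzero[OF A that(1)] by simp
  qed
  have ind: "?n l $ (i + 1) * ?n m $ (i + 2) - ?n m $ (i + 1) * ?n l $ (i + 2) \<noteq> 0"
    if lm: "l \<in> A" "m \<in> A" "l \<noteq> m" and on: "dot (?n l) v = 0" "dot (?n m) v = 0" for l m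
  proof
    assume *: "?n l $ (i + 1) * ?n m $ (i + 2) - ?n m $ (i + 1) * ?n l $ (i + 2) = 0"
    obtain c where "v = c *s cross (?n l) (?n m)"
      using orthogonal_both_imp_scaled[OF cross_normal_vec[OF A lm] on] .
    hence "v $ i = c * (cross (?n l) (?n m) $ i)" by simp
    also have "cross (?n l) (?n m) $ i = 0" using * by (simp add: cross_def mult.commute)
    finally show False using v(1) by simp
  qed
  have "{l \<in> A. vanishes_at l p} = {l \<in> A. dot (?n l) v = 0}"
    using vanishes_at_line_pts[OF A _ p] span_in_line_pts[OF v(3)] v(2) by auto
  hence "mult_at A p = card {l \<in> A. dot (?n l) v = 0}" by (simp add: mult_at_def)
  moreover have "local_eq (\<Prod>A) p = (\<Prod>l\<in>A. F l)"
    unfolding local_eq_def Let_def i_def[symmetric] v_def[symmetric] F_def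
    by (subst subst_prod[OF hom, of _ "\<lambda>x. x", symmetric]) (simp add: \<phi>_def[abs_def])
  moreover have "(card {l \<in> A. dot (?n l) v = 0} - 1)\<^sup>2 \<le> quotient_dim (tjurina_ideal (\<Prod>l\<in>A. F l))"
    using fin F ne ind by (rule tjurina_number_ge)
  ultimately show ?thesis by (simp only: tjurina_at_def)
qed

lemma sum_squares_le_tjurina:
  assumes A: "line_arrangement A"
  shows "(\<Sum>p\<in>multiple line_pts (normal_vec ` A). (deg line_pts (normal_vec ` A) p - 1)\<^sup>2) \<le> tjurina (\<Prod>A)"
  unfolding tjurina_def singular_points_eq_multiple[OF A]
proof (rule sum_mono)
  fix p assume "p \<in> multiple line_pts (normal_vec ` A)"
  hence "p \<in> P2"
    unfolding singular_points_eq_multiple[OF A, symmetric] by (simp add: singular_points_def curve_def)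
  thus "(deg line_pts (normal_vec ` A) p - 1)\<^sup>2 \<le> tjurina_at (\<Prod>A) p"
    using tjurina_at_ge[OF A] mult_at_eq_deg[OF A] by simp
qed

section \<open>The tangent form of a Jacobian syzygy\<close>

lemma eval_arrangement_nonzero:
  assumes A: "line_arrangement A"
  shows "\<exists>w. eval (\<Prod>A) w \<noteq> 0"
proof -
  have "\<exists>w\<in>UNIV. (\<Prod>l\<in>A. eval l w) \<noteq> 0"
  proof (rule hform_prod_nonzero_on[where k = "\<lambda>_. 1"])
    fix l assume l: "l \<in> A"
    show "hform 1 (eval l)" by (rule hform_eval[OF line_arrangement_linear[OF A l]])
    obtain w where "dot (normal_vec l) w = 1"
      using dot_eq_1_exists[OF normal_vec_nonzero[OF A l]] .
    hence "eval l w \<noteq> 0" using eval_linear[OF line_arrangement_linear[OF A l], of w] by simp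
    thus "\<exists>w\<in>UNIV. eval l w \<noteq> 0" by blast
  qed (use line_arrangement_finite[OF A] in auto)
  thus ?thesis using eval_prod[where F = "\<lambda>x. x" and X = A] by auto
qed

lemma homogeneous_arrangement:
  "line_arrangement A \<Longrightarrow> homogeneous (card A) (\<Prod>A)"
  using homogeneous_prod[of A "\<lambda>x. x"] by (simp add: line_arrangement_def)

lemma euler_arrangement:
  assumes A: "line_arrangement A"
  shows "(\<Sum>i\<in>UNIV. v $ i * eval (pdiff i (\<Prod>A)) v) = of_nat (card A) * eval (\<Prod>A) v"
proof -
  have fin: "finite A" by (rule line_arrangement_finite[OF A])
  have "dot (normal_vec l) v * (\<Prod>m\<in>A - {l}. eval m v) = eval (\<Prod>A) v" if "l \<in> A" for l
  proof -
    have "eval (\<Prod>A) v = (\<Prod>l\<in>A. eval l v)" using eval_prod[where F = "\<lambda>x. x" and X = A] by simp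
    also have "\<dots> = eval l v * (\<Prod>m\<in>A - {l}. eval m v)" by (rule prod.remove[OF fin that])
    finally show ?thesis using eval_linear[OF line_arrangement_linear[OF A that]] by simp
  qed
  thus ?thesis unfolding directional_derivative[OF A] by simp
qed

text \<open>A Koszul syzygy, with entries a partial derivative that is not zero and the negative of
  another one.\<close>

lemma AR_deg_ne_zero:
  assumes A: "line_arrangement A" "A \<noteq> {}"
  shows "AR_deg (\<Prod>A) (card A - 1) \<noteq> {0}"
proof -
  let ?f = "\<Prod>A"
  have card: "card A > 0" using A line_arrangement_finite by (simp add: card_gt_0_iff)
  obtain w where "eval ?f w \<noteq> 0" using eval_arrangement_nonzero[OF A(1)] by blast
  hence "(\<Sum>i\<in>UNIV. w $ i * eval (pdiff i ?f) w) \<noteq> 0"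
    using euler_arrangement[OF A(1), of w] card by simp
  then obtain i where "w $ i * eval (pdiff i ?f) w \<noteq> 0" by (metis (no_types, lifting) sum.neutral)
  hence i: "pdiff i ?f \<noteq> 0" by auto
  define s :: "S ^ 3" where
    "s = (\<chi> k. if k = i + 1 then pdiff i ?f else if k = i then - pdiff (i + 1) ?f else 0)"
  have hom: "homogeneous (card A - 1) (pdiff j ?f)" for j
    using homogeneous_arrangement[OF A(1)] card by (intro homogeneous_pdiff) simp
  have "(\<Sum>k\<in>UNIV. s $ k * pdiff k ?f) = 0"
    unfolding sum_3 s_def using exhaust_3[of i] by (elim disjE) (simp_all add: mult.commute)
  hence "s \<in> AR_deg ?f (card A - 1)"
    using hom by (auto simp: AR_deg_def AR_def s_def intro: homogeneous_uminus)
  moreover have "s \<noteq> 0"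
  proof
    assume "s = 0"
    hence "s $ (i + 1) = 0" by simp
    thus False using i by (simp add: s_def)
  qed
  ultimately show ?thesis by auto
qed

text \<open>Write the syzygy as a vector field D and \<open>n\<^sub>m\<close> for the normal vector of the line m.  On a
  line l of the arrangement, only one summand of
  \<open>D f = \<Sum> (n\<^sub>m \<cdot> D) f / m\<close> is not divisible by l, so \<open>n\<^sub>l \<cdot> D\<close> vanishes there, which
  is the tangency of \<open>\<omega>(v) = v \<times> D(v)\<close>.  If \<open>\<omega>\<close> were zero, D would be parallel to v, and
  by Euler's identity each component of D would have product zero with f.\<close>

lemma syzygy_tangent_form:
  assumes A: "line_arrangement A" "A \<noteq> {}"
    and s: "s \<in> AR_deg (\<Prod>A) r" "s \<noteq> 0"
  obtains \<omega> x where "vector_form (Suc r) \<omega>" "\<And>n. n \<in> normal_vec ` A \<Longrightarrow> tangent \<omega> n" "\<omega> x \<noteq> 0"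
proof -
  let ?f = "\<Prod>A"
  have fin: "finite A" by (rule line_arrangement_finite[OF A(1)])
  define D :: "complex ^ 3 \<Rightarrow> complex ^ 3" where "D v = (\<chi> i. eval (s $ i) v)" for v
  define \<omega> where "\<omega> v = cross v (D v)" for v
  have D: "hform r (\<lambda>v. D v $ i)" for i
    using s(1) hform_eval by (simp add: D_def AR_deg_def)
  have syz: "(\<Sum>i\<in>UNIV. D v $ i * eval (pdiff i ?f) v) = 0" for v
  proof -
    have "(\<Sum>i\<in>UNIV. s $ i * pdiff i ?f) = 0" using s(1) by (simp add: AR_deg_def AR_def)
    hence "eval (\<Sum>i\<in>UNIV. s $ i * pdiff i ?f) v = 0" by simp
    thus ?thesis by (simp add: eval_sum eval_mult D_def)
  qed
  have "hform (r + 1) (\<lambda>v. v $ (i + 1) * D v $ (i + 2) - v $ (i + 2) * D v $ (i + 1))" for i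
    by (intro hform_diff hform_coord_times D)
  hence vf: "vector_form (Suc r) \<omega>" by (simp add: vector_form_def \<omega>_def cross_def)
  have tan: "tangent \<omega> n" if n: "n \<in> normal_vec ` A" for n
    unfolding tangent_def
  proof (intro allI impI)
    fix v assume v: "dot n v = 0"
    obtain l where l: "l \<in> A" "n = normal_vec l" using n by blast
    have lin: "homogeneous 1 m" if "m \<in> A" for m by (rule line_arrangement_linear[OF A(1) that])
    let ?W = "{v. dot n v = 0}" and ?h = "\<lambda>v. \<Prod>m\<in>A - {l}. eval m v"
    have W: "v + t *s w \<in> ?W" if "v \<in> ?W" "w \<in> ?W" for v w t
      using that by (simp add: dot_add dot_scale)
    have hm: "hform 1 (eval m)" if "m \<in> A - {l}" for m by (rule hform_eval[OF lin]) (use that in auto)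
    have h: "hform (\<Sum>m\<in>A - {l}. 1) ?h" using fin hm by (intro hform_prod) auto
    have "\<exists>w\<in>?W. ?h w \<noteq> 0"
    proof (rule hform_prod_nonzero_on[where k = "\<lambda>_. 1", OF _ hm])
      fix m assume m: "m \<in> A - {l}"
      hence "cross n (normal_vec m) \<noteq> 0" using cross_normal_vec[OF A(1) l(1), of m] l by auto
      then obtain w where "dot n w = 0" "dot (normal_vec m) w \<noteq> 0" using exists_on_plane_off_plane by blast
      thus "\<exists>w\<in>?W. eval m w \<noteq> 0" using eval_linear[OF lin] m by auto
    next
      show "?W \<noteq> {}" using v by blast
    qed (use fin W in auto)
    then obtain w where w: "w \<in> ?W" "?h w \<noteq> 0" by blast
    have g: "hform r (\<lambda>v. dot n (D v))"
      unfolding dot_def by (intro hform_sum hform_cmult D)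
    have "dot n (D v) = 0"
    proof (rule hform_mult_eq_0_on[OF g h W _ w])
      fix x assume x: "x \<in> ?W"
      have "0 = (\<Sum>y\<in>A. dot (normal_vec y) (D x) * (\<Prod>m\<in>A - {y}. eval m x))"
        using syz directional_derivative[OF A(1)] by simp
      also have "\<dots> = dot (normal_vec l) (D x) * ?h x
          + (\<Sum>y\<in>A - {l}. dot (normal_vec y) (D x) * (\<Prod>m\<in>A - {y}. eval m x))"
        by (rule sum.remove[OF fin l(1)])
      also have "(\<Sum>y\<in>A - {l}. dot (normal_vec y) (D x) * (\<Prod>m\<in>A - {y}. eval m x)) = 0"
      proof (intro sum.neutral ballI)
        fix y assume y: "y \<in> A - {l}"
        have "eval l x = 0" using x l eval_linear[OF lin[OF l(1)]] by simp
        thus "dot (normal_vec y) (D x) * (\<Prod>m\<in>A - {y}. eval m x) = 0" using y l(1) fin by auto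
      qed
      finally show "dot n (D x) * ?h x = 0" using l by simp
    qed (use v in auto)
    moreover have "cross (cross v (D v)) n = dot n v *s D v - dot n (D v) *s v"
      by (simp add: vec_eq_iff forall_3 cross_simps dot_simps algebra_simps)
    ultimately show "cross (\<omega> v) n = 0" using v by (simp add: \<omega>_def)
  qed
  have "\<exists>x. \<omega> x \<noteq> 0"
  proof (rule ccontr)
    assume "\<nexists>x. \<omega> x \<noteq> 0"
    hence par: "v $ i * D v $ j = v $ j * D v $ i" for v i j
      using cross_eq_0_iff[of v "D v"] by (auto simp: \<omega>_def)
    have prod0: "D v $ j * eval ?f v = 0" for v j
    proof -
      have "D v $ j * (of_nat (card A) * eval ?f v) = (\<Sum>i\<in>UNIV. (v $ i * D v $ j) * eval (pdiff i ?f) v)"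
        unfolding euler_arrangement[OF A(1), symmetric] by (simp add: sum_distrib_left mult_ac)
      also have "\<dots> = v $ j * (\<Sum>i\<in>UNIV. D v $ i * eval (pdiff i ?f) v)"
        unfolding par[of v _ j] by (simp add: sum_distrib_left mult.assoc)
      finally show ?thesis using syz A fin by auto
    qed
    obtain w where w: "eval ?f w \<noteq> 0" using eval_arrangement_nonzero[OF A(1)] by blast
    have "D v $ j = 0" for v j
      by (rule hform_mult_eq_0_on[OF D hform_eval[OF homogeneous_arrangement[OF A(1)]], of UNIV _ w])
         (use prod0 w in auto)
    hence "eval (s $ j) v = 0" for j v by (simp add: D_def)
    moreover have "homogeneous r (s $ j)" for j using s(1) by (simp add: AR_deg_def)
    ultimately have "s $ j = 0" for j using eval_eq_0_imp_zero by blast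
    thus False using s(2) by (simp add: vec_eq_iff)
  qed
  thus ?thesis using that vf tan by blast
qed

lemma dot_commute: "dot n v = dot v n"
  by (simp add: dot_def mult.commute)

section \<open>The lower bound for the global Tjurina number\<close>

lemma line_has_another_point:
  assumes n: "n \<noteq> 0"
  shows "\<exists>p\<in>line_pts n. p \<noteq> q"
proof -
  have "\<exists>v. cross u v \<noteq> 0 \<and> dot n v = 0" if u: "u \<noteq> 0" "dot n u = 0" for u
  proof -
    obtain i where i: "u $ i \<noteq> 0" using u by (auto simp: vec_eq_iff)
    have "cross u (cross n (axis i 1)) = u $ i *s n"
      using u(2) by (simp add: cross_cross dot_commute[of "axis i 1"] dot_axis)
    thus ?thesis using i n dot_cross(1)[of n] by (metis vector_mul_eq_0)
  qed
  note other = this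
  have "\<exists>v. v \<noteq> 0 \<and> dot n v = 0"
  proof (rule ccontr)
    assume "\<not> ?thesis"
    hence "cross n (axis 1 1) = 0" "cross n (axis 2 1) = 0" using dot_cross(1) by blast+
    moreover have "cross (axis 1 1) (axis 2 1) \<noteq> (0 :: complex ^ 3)"
      by (simp add: vec_eq_iff forall_3 cross_simps axis_def)
    ultimately show False using parallel_both_imp_zero n by blast
  qed
  then obtain u where u: "u \<noteq> 0" "dot n u = 0" by blast
  obtain v where v: "cross u v \<noteq> 0" "dot n v = 0" using other[OF u] by blast
  have v0: "v \<noteq> 0" using v(1) cross_scaled(2)[of u 0] by auto
  have "vec.span {u} \<noteq> vec.span {v}"
  proof
    assume "vec.span {u} = vec.span {v}"
    hence "v \<in> vec.span {u}" by (simp add: vec.span_base)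
    then obtain c where "v = c *s u" by (auto simp: vec.span_singleton)
    thus False using v(1) by simp
  qed
  moreover have "vec.span {u} \<in> line_pts n" "vec.span {v} \<in> line_pts n"
    using u v v0 span_in_line_pts by auto
  ultimately show ?thesis by metis
qed

text \<open>The points p and q attain the two maxima in \<open>second_mult\<close>.  They exist because a curve that
  contains a line has points besides p.\<close>

lemma two_points_of_multiplicity:
  assumes A: "line_arrangement A" "A \<noteq> {}" and k: "k \<le> second_mult A"
  obtains p q where "p \<noteq> q" "k \<le> deg line_pts (normal_vec ` A) p" "k \<le> deg line_pts (normal_vec ` A) q"
proof -
  let ?C = "curve (\<Prod>A)"
  have fin: "finite A" by (rule line_arrangement_finite[OF A(1)])
  obtain l where l: "l \<in> A" using A by blast
  have another: "\<exists>p\<in>?C. p \<noteq> q" for q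
  proof -
    obtain p where p: "p \<in> line_pts (normal_vec l)" "p \<noteq> q"
      using line_has_another_point[OF normal_vec_nonzero[OF A(1) l]] by blast
    hence "p \<in> P2" by (simp add: line_pts_def)
    hence "vanishes_at l p" using vanishes_at_line_pts[OF A(1) l] p by blast
    hence "vanishes_at (\<Prod>A) p"
      using fin l eval_prod[where F = "\<lambda>x. x" and X = A] by (auto simp: vanishes_at_def)
    thus ?thesis using p \<open>p \<in> P2\<close> by (auto simp: curve_def)
  qed
  have finim: "finite (mult_at A ` X)" for X
    by (rule finite_subset[of _ "{..card A}"]) (auto simp: mult_at_def fin intro: card_mono)
  define p where "p = (SOME p. p \<in> ?C \<and> mult_at A p = max_mult A)"
  have "max_mult A \<in> mult_at A ` ?C"
    unfolding max_mult_def using another finim by (intro Max_in) auto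
  hence "\<exists>p. p \<in> ?C \<and> mult_at A p = max_mult A" by force
  hence "p \<in> ?C \<and> mult_at A p = max_mult A" unfolding p_def by (rule someI_ex)
  hence p: "p \<in> ?C" "mult_at A p = max_mult A" by auto
  have "second_mult A = Max (mult_at A ` (?C - {p}))"
    by (simp add: second_mult_def p_def)
  moreover have "Max (mult_at A ` (?C - {p})) \<in> mult_at A ` (?C - {p})"
    using another[of p] finim by (intro Max_in) auto
  ultimately obtain q where q: "q \<in> ?C" "q \<noteq> p" "second_mult A = mult_at A q" by auto
  have "mult_at A q \<le> mult_at A p"
    unfolding p(2) max_mult_def using q finim by (intro Max_ge) auto
  moreover have "p \<in> P2" "q \<in> P2" using p q by (auto simp: curve_def)
  ultimately show ?thesis
    using that[of p q] q k mult_at_eq_deg[OF A(1)] by simp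
qed

theorem corollary1p4:
  fixes A :: "S set" and f :: S and d r :: nat
  assumes "line_arrangement A" and "card A = d" and "f = \<Prod>A"
    and "\<not> free_curve f"
    and "r = mdr f" and "r \<ge> 3"
    and "second_mult A \<ge> 3"
  shows "int (tjurina f) \<ge> tau_min d r + int (r choose 2) + 4
       \<and> tau_min d r + int (r choose 2) + 4 \<ge> tau_min d r + 7"
proof -
  note A = assms(1)
  let ?N = "normal_vec ` A"
  have A0: "A \<noteq> {}"
  proof
    assume "A = {}"
    hence "f = 1" using assms(3) by simp
    hence "(\<chi> i. 1) \<in> AR_deg f 0" by (simp add: AR_deg_def AR_def homogeneous_1)
    moreover have "(\<chi> i. 1) \<noteq> (0 :: S ^ 3)" by (simp add: vec_eq_iff)
    ultimately have "AR_deg f 0 \<noteq> {0}" by blast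
    hence "mdr f \<le> 0" unfolding mdr_def by (rule Least_le)
    thus False using assms by simp
  qed
  have Koszul: "AR_deg f (d - 1) \<noteq> {0}" using AR_deg_ne_zero[OF A A0] assms by simp
  hence "r \<le> d - 1" unfolding assms(5) mdr_def by (rule Least_le)
  moreover have "d > 0" using A0 line_arrangement_finite[OF A] assms(2) by (auto simp: card_gt_0_iff)
  ultimately have rd: "Suc r \<le> card ?N"
    using card_image[OF inj_on_normal_vec[OF A]] assms(2) by simp
  have "AR_deg f r \<noteq> {0}" unfolding assms(5) mdr_def using Koszul by (rule LeastI)
  moreover have "0 \<in> AR_deg f r" by (simp add: AR_deg_def AR_def)
  ultimately obtain s where "s \<in> AR_deg (\<Prod>A) r" "s \<noteq> 0" using assms(3) by blast
  then obtain \<omega> x where \<omega>: "vector_form (Suc r) \<omega>" "\<And>n. n \<in> ?N \<Longrightarrow> tangent \<omega> n" "\<omega> x \<noteq> 0"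
    using syzygy_tangent_form[OF A A0] by metis
  obtain p q where pq: "p \<noteq> q" "3 \<le> deg line_pts ?N p" "3 \<le> deg line_pts ?N q"
    using two_points_of_multiplicity[OF A A0 assms(7)] .
  let ?\<sigma> = "excess line_pts ?N"
  have card: "card ?N = d" using card_image[OF inj_on_normal_vec[OF A]] assms(2) by simp
  have "2 * ?\<sigma> + Suc r * (Suc r + 1) + 2 \<le> 2 * card ?N * Suc r"
    using excess_le_of_tangent_form[OF \<omega>(1) normals_arrangement[OF A] \<omega>(2,3) rd] pq by blast
  hence "int (2 * ?\<sigma> + Suc r * (Suc r + 1) + 2) \<le> int (2 * d * Suc r)"
    unfolding card by (simp only: of_nat_le_iff)
  hence 1: "2 * int ?\<sigma> + (int r + 1) * (int r + 2) + 2 \<le> 2 * int d * (int r + 1)"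
    by (simp add: algebra_simps)
  have "d * (d - 1) \<le> tjurina f + ?\<sigma>"
    using sum_squares_plus_excess[OF linear_family_normals[OF normals_arrangement[OF A]]]
      sum_squares_le_tjurina[OF A] card assms(3) by simp
  hence "int (d * (d - 1)) \<le> int (tjurina f + ?\<sigma>)" by (simp only: of_nat_le_iff)
  hence 2: "int d * (int d - 1) \<le> int (tjurina f) + int ?\<sigma>"
    using \<open>d > 0\<close> by (simp add: of_nat_diff)
  have "even (r * (r - 1))" by (cases "even r") simp_all
  hence "2 * (r choose 2) = r * (r - 1)" by (simp add: choose_two)
  hence "int (2 * (r choose 2)) = int (r * (r - 1))" by (simp only:)
  hence 3: "2 * int (r choose 2) = int r * (int r - 1)"
    using assms(6) by (simp add: of_nat_diff)
  have "3 * (3 - 1) \<le> int r * (int r - 1)" using assms(6) by (intro mult_mono) auto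
  hence "int (r choose 2) \<ge> 3" using 3 by simp
  \<comment> \<open>The two sides differ by at least \<open>2 (r - 3)\<close>.\<close>
  moreover have "2 * (tau_min d r + int (r choose 2) + 4) \<le> 2 * int (tjurina f)"
    using 1 2 3 assms(6) unfolding tau_min_def by (simp add: algebra_simps)
  ultimately show ?thesis by simp
qed

end
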